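(* For all integers $k\ge 1$ and $n\ge 1$, \[\overline{M}_k(n)>\overline{N}_k(n).\]
   Context: For a partition $\lambda$ with parts $\lambda_1\ge\cdots\ge\lambda_\ell>0$, its rank is $\lambda_1-\ell$. Its crank is $\lambda_1$ if $\lambda$ has no part equal to $1$, and otherwise is (the number of parts larger than the number of ones) minus (the number of ones). $N(m,n)$ is the number of partitions of $n$ with rank $m$. For $n\ge2$, $M(m,n)$ is the number of partitions of $n$ with crank $m$; for $n=1$ one sets $M(0,1)=-1$, $M(\pm1,1)=1$, $M(m,1)=0$ for $|m|\ge 2$. The positive rank and crank moments are $\overline{N}_k(n)=\sum_{m\ge1}m^kN(m,n)$ and $\overline{M}_k(n)=\sum_{m\ge1}m^kM(m,n)$. *)

theory Defs
  imports Main "HOL-Library.Multiset"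
begin

definition partitions :: "nat \<Rightarrow> nat multiset set" where
  "partitions n = {p. (\<forall>x\<in>#p. 0 < x) \<and> sum_mset p = n}"

definition largest_part :: "nat multiset \<Rightarrow> nat" where
  "largest_part p = (if p = {#} then 0 else Max (set_mset p))"

definition rank :: "nat multiset \<Rightarrow> int" where
  "rank p = int (largest_part p) - int (size p)"

definition crank :: "nat multiset \<Rightarrow> int" where
  "crank p = (let w = count p 1 in
     if w = 0 then int (largest_part p)
     else int (size (filter_mset (\<lambda>x. x > w) p)) - int w)"

definition N :: "int \<Rightarrow> nat \<Rightarrow> int" where
  "N m n = int (card {p \<in> partitions n. rank p = m})"

definition M :: "int \<Rightarrow> nat \<Rightarrow> int" where
  "M m n = (if n = 1 then (if m = 0 then -1 else if m = 1 \<or> m = -1 then 1 else 0)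
            else int (card {p \<in> partitions n. crank p = m}))"

text \<open>Positive moments. The sum over m \<ge> 1 is finite: for partitions of n,
  ranks and cranks lie in [-n, n], so N m n = M m n = 0 for m > n.\<close>
definition pos_rank_moment :: "nat \<Rightarrow> nat \<Rightarrow> int" where
  "pos_rank_moment k n = (\<Sum>m\<in>{1..int n}. m ^ k * N m n)"

definition pos_crank_moment :: "nat \<Rightarrow> nat \<Rightarrow> int" where
  "pos_crank_moment k n = (\<Sum>m\<in>{1..int n}. m ^ k * M m n)"

end

theory Submission
  imports Defs "HOL-Computational_Algebra.Formal_Power_Series"
begin

text \<open>
  The function \<open>m \<mapsto> m ^ k\<close> is convex, so after summing by parts twice both moments are
  nonnegative combinations of the sums of \<open>(m - j)\<^sup>+\<close> over the crank and the rank. It suffices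
  that for every \<open>j\<close> the crank sum dominates the rank sum, strictly for \<open>j = 0\<close>. The generating
  function of their difference is that of the spt-crank of Andrews, Garvan and Liang. With
  \<open>P = 1/(q)\<^sub>\<infinity>\<close>, the tails \<open>F\<^sub>r\<close>, \<open>R\<^sub>r\<close> (crank, respectively rank, at least \<open>r\<close>) satisfy
  \<open>F\<^sub>r = q\<^sup>r (P - F\<^sub>r\<^sub>+\<^sub>1)\<close> and \<open>R\<^sub>r = q\<^sup>r\<^sup>+\<^sup>1 (P - R\<^sub>r\<^sub>+\<^sub>3)\<close>. Unfolding these turns
  \<open>\<Sum>r>j. F\<^sub>r - R\<^sub>r\<close> into an alternating sum of powers of \<open>q\<close> times
  \<open>P - F\<^sub>r = \<Sum>k. q\<^bsup>k(k+r)\<^esup> / ((q)\<^sub>k (q)\<^bsub>k+r-1\<^esub>)\<close> for \<open>r = j+2, j+4, \<dots>\<close>, in which consecutive terms pair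
  up with nonnegative difference.
\<close>

unbundle fps_syntax

section \<open>Locally finite sums and q-Pochhammer symbols\<close>

text \<open>Under \<open>locfin f\<close> the truncation at \<open>k \<le> n\<close> in \<open>lfs\<close> loses nothing; without it \<open>lfs f\<close> is junk.\<close>
definition locfin :: "(nat \<Rightarrow> real fps) \<Rightarrow> bool" where
  "locfin f \<longleftrightarrow> (\<forall>k n. n < k \<longrightarrow> f k $ n = 0)"

definition lfs :: "(nat \<Rightarrow> real fps) \<Rightarrow> real fps" where
  "lfs f = Abs_fps (\<lambda>n. \<Sum>k\<le>n. f k $ n)"

lemma lfs_nth:
  assumes "locfin f" "n \<le> K"
  shows "lfs f $ n = (\<Sum>k\<le>K. f k $ n)"
proof -
  have "(\<Sum>k\<le>K. f k $ n) = (\<Sum>k\<le>n. f k $ n)"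
    by (rule sum.mono_neutral_right) (use assms in \<open>auto simp: locfin_def\<close>)
  then show ?thesis by (simp add: lfs_def)
qed

lemma lfs_add: "lfs (\<lambda>k. f k + g k) = lfs f + lfs g"
  by (rule fps_ext) (simp add: lfs_def sum.distrib)

lemma lfs_diff: "lfs (\<lambda>k. f k - g k) = lfs f - lfs g"
  by (rule fps_ext) (simp add: lfs_def sum_subtractf)

lemma lfs_uminus: "lfs (\<lambda>k. - f k) = - lfs f"
  by (rule fps_ext) (simp add: lfs_def sum_negf)

lemma lfs_mult:
  assumes "locfin f"
  shows "lfs (\<lambda>k. c * f k) = c * lfs f"
proof (rule fps_ext)
  fix n
  have "(c * lfs f) $ n = (\<Sum>i=0..n. c $ i * (\<Sum>k\<le>n. f k $ (n - i)))"
    unfolding fps_mult_nth by (intro sum.cong refl) (simp add: lfs_nth[OF assms])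
  also have "\<dots> = (\<Sum>k\<le>n. \<Sum>i=0..n. c $ i * f k $ (n - i))"
    unfolding sum_distrib_left by (rule sum.swap)
  finally show "lfs (\<lambda>k. c * f k) $ n = (c * lfs f) $ n"
    by (simp add: lfs_def fps_mult_nth)
qed

lemma lfs_Suc:
  assumes "locfin f"
  shows "lfs f = f 0 + lfs (\<lambda>k. f (Suc k))"
proof (rule fps_ext)
  fix n
  \<comment> \<open>One term more than the truncation of \<open>lfs\<close>, because the shifted sum
    reaches index \<open>n + 1\<close>.\<close>
  have "lfs f $ n = (\<Sum>k\<le>Suc n. f k $ n)"
    by (rule lfs_nth[OF assms]) simp
  then show "lfs f $ n = (f 0 + lfs (\<lambda>k. f (Suc k))) $ n"
    by (simp add: lfs_def sum.atMost_Suc_shift del: sum.atMost_Suc)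
qed

lemma lfs_telescope:
  assumes "locfin U"
  shows "lfs (\<lambda>k. U k - U (Suc k)) = U 0"
  using lfs_Suc[OF assms] by (simp add: lfs_diff)

lemma locfin_shift: "(\<And>k. k \<le> e k) \<Longrightarrow> locfin (\<lambda>k. fps_X ^ e k * g k)"
  unfolding locfin_def fps_X_power_mult_nth by (meson less_le_trans)

section \<open>Series with nonnegative coefficients\<close>

definition nonneg_coeffs :: "real fps \<Rightarrow> bool" where
  "nonneg_coeffs f \<longleftrightarrow> (\<forall>n. 0 \<le> f $ n)"

lemma nonneg_coeffs_add: "nonneg_coeffs f \<Longrightarrow> nonneg_coeffs g \<Longrightarrow> nonneg_coeffs (f + g)"
  by (simp add: nonneg_coeffs_def)

lemma nonneg_coeffs_mult: "nonneg_coeffs f \<Longrightarrow> nonneg_coeffs g \<Longrightarrow> nonneg_coeffs (f * g)"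
  by (simp add: nonneg_coeffs_def fps_mult_nth sum_nonneg)

lemma nonneg_coeffs_fps_X_power: "nonneg_coeffs (fps_X ^ m)"
  by (simp add: nonneg_coeffs_def)

lemma nonneg_coeffs_lfs: "(\<And>k. nonneg_coeffs (f k)) \<Longrightarrow> nonneg_coeffs (lfs f)"
  by (simp add: nonneg_coeffs_def lfs_def sum_nonneg)

section \<open>q-Pochhammer symbols and their inverses\<close>

definition qpoch :: "nat \<Rightarrow> real fps" where
  "qpoch k = (\<Prod>i=1..k. 1 - fps_X ^ i)"

definition qinv :: "nat \<Rightarrow> real fps" where
  "qinv k = inverse (qpoch k)"

lemma qpoch_0: "qpoch 0 = 1"
  by (simp add: qpoch_def)

lemma qpoch_Suc: "qpoch (Suc k) = qpoch k * (1 - fps_X ^ Suc k)"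
  unfolding qpoch_def by simp

lemma qpoch_nth_0: "qpoch k $ 0 = 1"
proof (induction k)
  case (Suc k)
  then show ?case unfolding qpoch_Suc by (simp only: fps_mult_nth_0) simp
qed (simp add: qpoch_0)

lemma qinv_0: "qinv 0 = 1"
  by (simp add: qinv_def qpoch_0)

lemma qpoch_qinv: "qpoch k * qinv k = 1"
  unfolding qinv_def by (metis qpoch_nth_0 inverse_mult_eq_1' zero_neq_one)

text \<open>Expressing the smaller inverse through the larger one gives summands a common
  denominator, so that only a polynomial identity in powers of \<open>fps_X\<close> remains.\<close>

lemma qinv_eq: "qinv k = (1 - fps_X ^ Suc k) * qinv (Suc k)"
proof -
  have "qinv k = qinv k * (qpoch (Suc k) * qinv (Suc k))"
    by (simp add: qpoch_qinv)
  also have "\<dots> = (qpoch k * qinv k) * ((1 - fps_X ^ Suc k) * qinv (Suc k))"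
    by (simp only: qpoch_Suc mult_ac)
  finally show ?thesis by (simp only: qpoch_qinv mult_1_left)
qed

lemma qinv_Suc: "qinv (Suc k) = qinv k * inverse (1 - fps_X ^ Suc k)"
  unfolding qinv_def qpoch_Suc by (rule fps_inverse_mult)

lemma inverse_one_minus_power:
  assumes "0 < m"
  shows "inverse (1 - fps_X ^ m) = Abs_fps (\<lambda>n. if m dvd n then 1 else (0::real))"
proof -
  let ?g = "Abs_fps (\<lambda>n. if m dvd n then 1 else (0::real))"
  have "?g * (1 - fps_X ^ m) = 1"
  proof (rule fps_ext)
    fix n
    have "m \<le> n \<Longrightarrow> m dvd n - m \<longleftrightarrow> m dvd n"
      by (metis dvd_add_triv_right_iff le_add_diff_inverse2)
    then show "(?g * (1 - fps_X ^ m)) $ n = 1 $ n"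
      using assms by (auto simp: right_diff_distrib fps_X_power_mult_right_nth dest: dvd_imp_le)
  qed
  then show ?thesis
    by (metis fps_inverse_unique mult.commute)
qed

lemma nonneg_coeffs_qinv: "nonneg_coeffs (qinv k)"
proof (induction k)
  case 0
  then show ?case by (simp add: qinv_0 nonneg_coeffs_def)
next
  case (Suc k)
  have "nonneg_coeffs (inverse (1 - fps_X ^ Suc k))"
    unfolding inverse_one_minus_power[OF zero_less_Suc] by (simp add: nonneg_coeffs_def)
  with Suc show ?case unfolding qinv_Suc by (rule nonneg_coeffs_mult)
qed

text \<open>For \<open>0 < i\<close> the factor cancels against the same factor of
  \<open>qpoch k\<close>, leaving a product of geometric series. This is how differences are seen to
  be nonnegative later.\<close>

lemma nonneg_coeffs_mult_qinv:
  assumes "i \<le> k"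
  shows "nonneg_coeffs ((1 - fps_X ^ i) * qinv k)"
proof (cases "i = 0")
  case True
  then show ?thesis by (simp add: nonneg_coeffs_def)
next
  case False
  from assms show ?thesis
  proof (induction k rule: dec_induct)
    case base
    from False obtain i' where "i = Suc i'" by (cases i) auto
    then show ?case by (simp only: qinv_eq[symmetric] nonneg_coeffs_qinv)
  next
    case (step k)
    have "nonneg_coeffs (inverse (1 - fps_X ^ Suc k))"
      unfolding inverse_one_minus_power[OF zero_less_Suc] by (simp add: nonneg_coeffs_def)
    from nonneg_coeffs_mult[OF step.IH this] show ?case
      by (simp only: qinv_Suc mult.assoc)
  qed
qed

section \<open>Tails of the crank distribution\<close>

text \<open>By dissection along Durfee rectangles this is \<open>P\<close> for every \<open>r\<close>; \<open>durfee_gf 0\<close> serves as \<open>P\<close>.\<close>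
definition durfee_gf :: "nat \<Rightarrow> real fps" where
  "durfee_gf r = lfs (\<lambda>k. fps_X ^ (k * (k + r)) * (qinv k * qinv (k + r)))"

text \<open>This is \<open>F\<^sub>r\<close>, written with nonnegative summands instead of the
  classical alternating series, so that different \<open>r\<close> can be compared term by
  term.\<close>

definition crank_ge :: "nat \<Rightarrow> real fps" where
  "crank_ge r = lfs (\<lambda>k. fps_X ^ ((k + 1) * (k + r)) * (qinv k * qinv (k + r)))"

text \<open>Index shift: this is \<open>P - F\<^sub>r\<^sub>+\<^sub>1\<close>, the series of crank at most \<open>r\<close>.\<close>
definition crank_le :: "nat \<Rightarrow> real fps" where
  "crank_le r = lfs (\<lambda>k. fps_X ^ (k * (k + r + 1)) * (qinv k * qinv (k + r)))"

text \<open>For \<open>1 \<le> r\<close> and \<open>0 < k\<close> the summand counts partitions with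
  \<open>k\<close> ones, parts from 2 to \<open>k\<close>, and exactly \<open>k + r\<close> parts
  above \<open>k\<close>. For \<open>k = 0\<close> it counts partitions without ones and with
  largest part \<open>r\<close>, except that for \<open>r = 1\<close> it is \<open>fps_X\<close>,
  standing for \<open>{#1#}\<close>.\<close>

definition crank_gf :: "nat \<Rightarrow> real fps" where
  "crank_gf r = lfs (\<lambda>k. fps_X ^ (k + (k + 1) * (k + r)) * ((1 - fps_X) * qinv k * qinv (k + r)))"

text \<open>The termwise difference telescopes. The factor \<open>1 - fps_X ^ k\<close> in
  \<open>U\<close> makes \<open>U 0\<close> vanish and turns \<open>qinv (Suc k)\<close> into
  \<open>qinv k\<close> in \<open>U (Suc k)\<close>.\<close>

lemma durfee_gf_Suc: "durfee_gf (Suc r) = durfee_gf r"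
proof -
  define U where "U k = fps_X ^ (k * (k + r)) * ((1 - fps_X ^ k) * qinv k * qinv (k + r))" for k
  have U: "locfin U"
    unfolding U_def by (rule locfin_shift) (auto simp: add_mult_distrib2 intro: trans_le_add1 le_square)
  have eq: "fps_X ^ (k * (k + r)) * (qinv k * qinv (k + r)) -
        fps_X ^ (k * (k + Suc r)) * (qinv k * qinv (k + Suc r)) = U k - U (Suc k)" for k
  proof -
    have 1: "qinv (k + r) = (1 - fps_X ^ (k + r + 1)) * qinv (k + Suc r)"
      using qinv_eq[of "k + r"] by simp
    have 2: "U (Suc k) = fps_X ^ (Suc k * (Suc k + r)) * (qinv k * qinv (k + Suc r))"
      unfolding U_def by (simp only: qinv_eq[symmetric]) simp
    have 3: "k * (k + Suc r) = k * (k + r) + k" "Suc k * (Suc k + r) = k * (k + r) + k + (k + r + 1)"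
      by simp_all
    \<comment> \<open>Here \<open>e\<close>, \<open>x\<close>, \<open>w\<close> stand for the powers
      with exponents \<open>k * (k + r)\<close>, \<open>k\<close>, \<open>k + r + 1\<close>, and
      \<open>a\<close>, \<open>b\<close> for \<open>qinv k\<close>, \<open>qinv (k + Suc r)\<close>.
      The later \<open>ring\<close> facts abstract in the same way.\<close>
    have ring: "e * (a * ((1 - w) * b)) - e * x * (a * b) =
        e * ((1 - x) * a * ((1 - w) * b)) - e * x * w * (a * b)" for e a b x w :: "real fps"
      by (simp add: algebra_simps)
    show ?thesis
      unfolding 2 unfolding U_def 1 3 power_add[of _ _ k] power_add[of _ _ "k + r + 1"] by (rule ring)
  qed
  have "durfee_gf r - durfee_gf (Suc r) = lfs (\<lambda>k. U k - U (Suc k))"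
    unfolding durfee_gf_def lfs_diff[symmetric] eq ..
  also have "\<dots> = 0"
    unfolding lfs_telescope[OF U] by (simp add: U_def)
  finally show ?thesis by simp
qed

lemma durfee_gf_eq: "durfee_gf r = durfee_gf 0"
  by (induction r) (simp_all add: durfee_gf_Suc)

text \<open>The exponents differ by \<open>r\<close>, as
  \<open>(k + 1) * (k + r) = r + k * (k + r + 1)\<close>. With the next lemma this is the recurrence
  for \<open>F\<^sub>r\<close>.\<close>

lemma crank_ge_eq_crank_le: "crank_ge r = fps_X ^ r * crank_le r"
proof -
  have "locfin (\<lambda>k. fps_X ^ (k * (k + r + 1)) * (qinv k * qinv (k + r)))"
    by (rule locfin_shift) simp
  from lfs_mult[OF this, of "fps_X ^ r"] show ?thesis
    unfolding crank_ge_def crank_le_def mult.assoc[symmetric] power_add[symmetric]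
    by (simp add: algebra_simps)
qed

text \<open>Each summand of \<open>durfee_gf (Suc r)\<close> splits by
  \<open>1 = w + (1 - w)\<close> with \<open>w = fps_X ^ (k + r + 1)\<close>; the factor
  \<open>1 - w\<close> lowers the index of \<open>qinv\<close>.\<close>

lemma crank_ge_plus_crank_le: "crank_ge (Suc r) + crank_le r = durfee_gf 0"
proof -
  have eq: "fps_X ^ ((k + 1) * (k + Suc r)) * (qinv k * qinv (k + Suc r)) +
        fps_X ^ (k * (k + r + 1)) * (qinv k * qinv (k + r)) =
        fps_X ^ (k * (k + Suc r)) * (qinv k * qinv (k + Suc r))" for k
  proof -
    have 1: "qinv (k + r) = (1 - fps_X ^ (k + r + 1)) * qinv (k + Suc r)"
      using qinv_eq[of "k + r"] by simp
    have 2: "(k + 1) * (k + Suc r) = k * (k + Suc r) + (k + r + 1)" "k + r + 1 = k + Suc r"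
      by simp_all
    have ring: "e * w * (a * b) + e * (a * ((1 - w) * b)) = e * (a * b)" for e a b w :: "real fps"
      by (simp add: algebra_simps)
    show ?thesis unfolding 1 2 power_add[of _ _ "k + Suc r"] by (rule ring)
  qed
  have "crank_ge (Suc r) + crank_le r = durfee_gf (Suc r)"
    unfolding crank_ge_def crank_le_def durfee_gf_def lfs_add[symmetric] eq ..
  then show ?thesis by (simp only: durfee_gf_eq[of "Suc r"])
qed

text \<open>The two sides agree termwise only up to the telescoping difference of \<open>V\<close>,
  and \<open>V 0 = 0\<close>.\<close>

lemma crank_gf_eq: "crank_gf r = crank_ge r - crank_ge (Suc r)"
proof -
  define V where "V k = fps_X ^ ((k + 1) * (k + r)) * ((1 - fps_X ^ k) * qinv k * qinv (k + r))" for k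
  have V: "locfin V"
    unfolding V_def by (rule locfin_shift) simp
  have eq: "(fps_X ^ ((k + 1) * (k + r)) * (qinv k * qinv (k + r)) -
        fps_X ^ ((k + 1) * (k + Suc r)) * (qinv k * qinv (k + Suc r))) -
        fps_X ^ (k + (k + 1) * (k + r)) * ((1 - fps_X) * qinv k * qinv (k + r)) = V k - V (Suc k)" for k
  proof -
    have 1: "qinv (k + r) = (1 - fps_X ^ (k + r + 1)) * qinv (k + Suc r)"
      using qinv_eq[of "k + r"] by simp
    have 2: "V (Suc k) = fps_X ^ (Suc (Suc k) * (Suc k + r)) * (qinv k * qinv (k + Suc r))"
      unfolding V_def by (simp only: qinv_eq[symmetric]) simp
    have 3: "(k + 1) * (k + Suc r) = (k + 1) * (k + r) + (k + 1)"
      "k + (k + 1) * (k + r) = (k + 1) * (k + r) + k"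
      "Suc (Suc k) * (Suc k + r) = (k + 1) * (k + r) + (k + 1) + (k + r + 1)"
      by simp_all
    have ring: "(e * (a * ((1 - w) * b)) - e * (x * y) * (a * b)) - e * x * ((1 - y) * a * ((1 - w) * b)) =
        e * ((1 - x) * a * ((1 - w) * b)) - e * (x * y) * w * (a * b)" for e a b x y w :: "real fps"
      by (simp add: algebra_simps)
    show ?thesis
      unfolding 2 unfolding V_def 1 3 power_add[of _ _ k] power_add[of _ _ "k + 1"]
        power_add[of _ _ "k + r + 1"] power_add[of _ k 1] power_one_right by (rule ring)
  qed
  have "(crank_ge r - crank_ge (Suc r)) - crank_gf r = lfs (\<lambda>k. V k - V (Suc k))"
    unfolding crank_ge_def crank_gf_def lfs_diff[symmetric] eq ..
  also have "\<dots> = 0"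
    unfolding lfs_telescope[OF V] by (simp add: V_def)
  finally show ?thesis by simp
qed

text \<open>Term 0 of \<open>crank_le r\<close> is \<open>qinv r\<close>. Its term
  \<open>k + 1\<close> is compared with term \<open>k\<close> of the shifted series, whose exponent
  is larger by just 1. The difference splits into multiples of \<open>1 - fps_X\<close> and
  \<open>1 - fps_X ^ r\<close>, both absorbed by \<open>qinv (k + r + 2)\<close>.\<close>

lemma crank_le_diff:
  "nonneg_coeffs (crank_le r - fps_X ^ (r + 3) * crank_le (r + 2) - qinv r)"
proof -
  have l: "locfin (\<lambda>k. fps_X ^ (k * (k + r' + 1)) * (qinv k * qinv (k + r')))" for r'
    by (rule locfin_shift) simp
  define t where "t k = fps_X ^ ((k + 1) * (k + r + 2)) * qinv (Suc k) *
    ((1 - fps_X ^ 1) * qinv (k + r + 2) + fps_X ^ (k + 2) * ((1 - fps_X ^ r) * qinv (k + r + 2)))" for k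
  have a: "crank_le r - qinv r =
      lfs (\<lambda>k. fps_X ^ (Suc k * (Suc k + r + 1)) * (qinv (Suc k) * qinv (Suc k + r)))"
    unfolding crank_le_def lfs_Suc[OF l] by (simp add: qinv_0)
  have b: "fps_X ^ (r + 3) * crank_le (r + 2) =
      lfs (\<lambda>k. fps_X ^ (r + 3) * (fps_X ^ (k * (k + (r + 2) + 1)) * (qinv k * qinv (k + (r + 2)))))"
    unfolding crank_le_def lfs_mult[OF l] ..
  have c: "fps_X ^ (Suc k * (Suc k + r + 1)) * (qinv (Suc k) * qinv (Suc k + r)) -
      fps_X ^ (r + 3) * (fps_X ^ (k * (k + (r + 2) + 1)) * (qinv k * qinv (k + (r + 2)))) = t k" for k
  proof -
    have 1: "qinv (Suc k + r) = (1 - fps_X ^ (k + r + 2)) * qinv (k + r + 2)"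
      using qinv_eq[of "Suc k + r"] by simp
    have 2: "k + (r + 2) = k + r + 2" "Suc k * (Suc k + r + 1) = (k + 1) * (k + r + 2)"
      by (simp_all del: mult_Suc mult_Suc_right)
    have 3: "r + 3 + k * (k + r + 2 + 1) = (k + 1) * (k + r + 2) + 1"
      by (simp add: algebra_simps)
    have 4: "fps_X ^ (r + 3) * (fps_X ^ (k * (k + r + 2 + 1)) * (g * h)) =
        fps_X ^ ((k + 1) * (k + r + 2)) * fps_X * (g * h :: real fps)" for g h
      using arg_cong[OF 3, of "\<lambda>e. fps_X ^ e * (g * h)"] by (simp only: power_add power_one_right mult.assoc)
    have 5: "fps_X ^ (k + r + 2) = fps_X ^ (k + 2) * (fps_X ^ r :: real fps)"
      "fps_X ^ (k + 2) = fps_X * (fps_X ^ Suc k :: real fps)"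
      unfolding power_add[symmetric] power_Suc[symmetric] by simp_all
    have ring: "e * (a * ((1 - x * u * v) * b)) - e * x * ((1 - u) * a * b) =
        e * a * ((1 - x) * b + x * u * ((1 - v) * b))" for e a x u v b :: "real fps"
      by (simp add: algebra_simps)
    show ?thesis
      unfolding t_def 1 2 4 qinv_eq[of k] 5 power_one_right by (rule ring)
  qed
  have "crank_le r - fps_X ^ (r + 3) * crank_le (r + 2) - qinv r =
      (crank_le r - qinv r) - fps_X ^ (r + 3) * crank_le (r + 2)"
    by simp
  also have "\<dots> = lfs t"
    unfolding a b lfs_diff[symmetric] c ..
  also have "nonneg_coeffs (lfs t)"
  proof (rule nonneg_coeffs_lfs)
    show "nonneg_coeffs (t k)" for k
    unfolding t_def
    by (intro nonneg_coeffs_mult nonneg_coeffs_add nonneg_coeffs_fps_X_power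
        nonneg_coeffs_qinv nonneg_coeffs_mult_qinv) simp_all
  qed
  finally show ?thesis .
qed

text \<open>Every summand contains \<open>qinv (k + r)\<close> with \<open>i \<le> k + r\<close>,
  which absorbs the factor.\<close>

lemma nonneg_coeffs_mult_crank_le:
  assumes "i \<le> r"
  shows "nonneg_coeffs ((1 - fps_X ^ i) * crank_le r)"
proof -
  have "locfin (\<lambda>k. fps_X ^ (k * (k + r + 1)) * (qinv k * qinv (k + r)))"
    by (rule locfin_shift) simp
  from lfs_mult[OF this, of "1 - fps_X ^ i"]
  have "(1 - fps_X ^ i) * crank_le r =
      lfs (\<lambda>k. fps_X ^ (k * (k + r + 1)) * (qinv k * ((1 - fps_X ^ i) * qinv (k + r))))"
    unfolding crank_le_def by (simp only: mult_ac)
  also have "nonneg_coeffs \<dots>"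
    using assms by (intro nonneg_coeffs_lfs nonneg_coeffs_mult nonneg_coeffs_fps_X_power
        nonneg_coeffs_qinv nonneg_coeffs_mult_qinv) simp
  finally show ?thesis .
qed

section \<open>Gaussian binomials and tails of the rank distribution\<close>

text \<open>The Gaussian binomial of \<open>a + b\<close> over \<open>a\<close>; indexing by both
  complementary sizes makes it symmetric and avoids subtraction.\<close>

definition qbin :: "nat \<Rightarrow> nat \<Rightarrow> real fps" where
  "qbin a b = qpoch (a + b) * qinv a * qinv b"

lemma qbin_commute: "qbin a b = qbin b a"
  by (simp add: qbin_def mult_ac add.commute)

lemma qbin_0: "qbin 0 b = 1"
  by (simp add: qbin_def qinv_0 qpoch_qinv)

lemma qbin_Suc_Suc: "qbin (Suc a) (Suc b) = qbin (Suc a) b + fps_X ^ Suc b * qbin a (Suc b)"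
proof -
  have 1: "qpoch (Suc a + Suc b) = qpoch (Suc (a + b)) * (1 - fps_X ^ Suc a * fps_X ^ Suc b)"
    using qpoch_Suc[of "Suc (a + b)"] by (simp add: power_add)
  have 2: "Suc a + b = Suc (a + b)" "a + Suc b = Suc (a + b)" by simp_all
  have ring: "p * (1 - x * y) * A * B = p * A * ((1 - y) * B) + y * (p * ((1 - x) * A) * B)"
    for p x y A B :: "real fps"
    by (simp add: algebra_simps)
  show ?thesis
    unfolding qbin_def 1 unfolding 2 qinv_eq[of a] qinv_eq[of b] by (rule ring)
qed

lemma qbin_Suc_Suc': "qbin (Suc a) (Suc b) = fps_X ^ Suc a * qbin (Suc a) b + qbin a (Suc b)"
  using qbin_Suc_Suc[of b a] by (simp add: qbin_commute)

text \<open>The summand counts partitions with \<open>k + 1\<close> parts and largest part \<open>k + 1 + m\<close>.\<close>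
definition rank_gf :: "nat \<Rightarrow> real fps" where
  "rank_gf m = lfs (\<lambda>k. fps_X ^ (2 * k + m + 1) * qbin k (k + m))"

lemma locfin_rank_gf: "locfin (\<lambda>k. fps_X ^ (2 * k + m + 1) * qbin k (k + m))"
  by (rule locfin_shift) simp

lemma rank_gf_nth_0: "n \<le> m \<Longrightarrow> rank_gf m $ n = 0"
  unfolding rank_gf_def lfs_def by (simp only: fps_nth_Abs_fps fps_X_power_mult_nth) simp

text \<open>This is the adjoint symmetry of \<open>rank_ge\<close> after differencing twice, which
  removes the unknown constant. Both sides equal \<open>- (fps_X ^ (2 * m + 6)) * S\<close>: the
  left by one q-Pascal rule, the right by the other one and telescoping.\<close>

lemma rank_gf_rec:
  "fps_X * rank_gf m - rank_gf (m + 1) = fps_X ^ (m + 2) * (fps_X * rank_gf (m + 4) - rank_gf (m + 3))"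
proof -
  define S where "S = lfs (\<lambda>k. fps_X ^ (3 * k) * qbin k (k + m + 2))"
  have S: "locfin (\<lambda>k. fps_X ^ (3 * k) * qbin k (k + m + 2))"
    by (rule locfin_shift) simp
  define t where "t k = fps_X ^ (2 * k + (m + 2)) * (qbin k (k + m) - qbin k (k + m + 1))" for k
  have t: "locfin t"
    unfolding t_def by (rule locfin_shift) simp
  have t_eq: "fps_X * (fps_X ^ (2 * k + m + 1) * qbin k (k + m)) -
      fps_X ^ (2 * k + (m + 1) + 1) * qbin k (k + (m + 1)) = t k" for k
  proof -
    have 1: "2 * k + (m + 2) = Suc (2 * k + m + 1)" "2 * k + (m + 1) + 1 = Suc (2 * k + m + 1)"
      "k + (m + 1) = k + m + 1" by simp_all
    show ?thesis
      unfolding t_def 1 power_Suc by (simp only: right_diff_distrib mult.assoc)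
  qed
  have t_0: "t 0 = 0"
    by (simp add: t_def qbin_0)
  have t_Suc: "t (Suc k) = (- (fps_X ^ (2 * m + 6))) * (fps_X ^ (3 * k) * qbin k (k + m + 2))" for k
  proof -
    have 1: "Suc k + m + 1 = Suc (Suc k + m)" "k + m + 2 = Suc (Suc k + m)" by simp_all
    have 2: "fps_X ^ (2 * Suc k + (m + 2)) * fps_X ^ Suc (Suc k + m) =
        fps_X ^ (2 * m + 6) * (fps_X ^ (3 * k) :: real fps)"
      unfolding power_add[symmetric] by (rule arg_cong[of _ _ "power _"]) simp
    have ring: "x * (u - (u + y * v)) = - (x * y) * v" for x y u v :: "real fps"
      by (simp add: algebra_simps)
    show ?thesis
      unfolding t_def 1 qbin_Suc_Suc ring 2 by (simp only: mult_minus_left mult.assoc)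
  qed
  have "fps_X * rank_gf m - rank_gf (m + 1) = lfs t"
    unfolding rank_gf_def lfs_mult[OF locfin_rank_gf, symmetric] lfs_diff[symmetric] t_eq ..
  also have "\<dots> = - (fps_X ^ (2 * m + 6)) * S"
    unfolding lfs_Suc[OF t] t_0 t_Suc lfs_mult[OF S] S_def by simp
  finally have lhs: "fps_X * rank_gf m - rank_gf (m + 1) = - (fps_X ^ (2 * m + 6)) * S" .

  \<comment> \<open>The case distinction encodes a Gaussian binomial with lower entry -1, which is
    0; truncated subtraction alone would give the entry 0 instead.\<close>
  define V where "V k = fps_X ^ (2 * k) * (if k = 0 then 0 else qbin (k - 1) (k + m + 3))" for k
  have V: "locfin V"
    unfolding V_def by (rule locfin_shift) simp
  have V_eq: "fps_X * (fps_X ^ (2 * k + (m + 4) + 1) * qbin k (k + (m + 4))) -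
      fps_X ^ (2 * k + (m + 3) + 1) * qbin k (k + (m + 3)) =
      (- (fps_X ^ (m + 4))) * (fps_X ^ (3 * k) * qbin k (k + m + 2) + (V k - V (Suc k)))" for k
  proof -
    have 1: "qbin k (k + (m + 3)) = fps_X ^ k * qbin k (k + m + 2) +
        (if k = 0 then 0 else qbin (k - 1) (k + m + 3))"
    proof (cases k)
      case 0
      then show ?thesis by (simp add: qbin_0)
    next
      case (Suc k')
      have "k + (m + 3) = Suc (k + m + 2)" "k + m + 3 = Suc (k + m + 2)" by simp_all
      with qbin_Suc_Suc'[of k' "k + m + 2"] Suc show ?thesis by (simp add: eval_nat_numeral)
    qed
    have 2: "V (Suc k) = fps_X ^ (2 * k) * (fps_X ^ 2 * qbin k (k + (m + 4)))"
    proof -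
      have "Suc k + m + 3 = k + (m + 4)" by simp
      then show ?thesis
        unfolding V_def by (simp only: mult_Suc_right power_add) simp
    qed
    have 3: "fps_X ^ (2 * k + (m + 4) + 1) = fps_X ^ (2 * k) * fps_X ^ (m + 4) * (fps_X :: real fps)"
      "fps_X ^ (2 * k + (m + 3) + 1) = fps_X ^ (2 * k) * (fps_X ^ (m + 4) :: real fps)"
      "fps_X ^ (3 * k) = fps_X ^ (2 * k) * (fps_X ^ k :: real fps)"
      unfolding power_add[symmetric] power_Suc2[symmetric]
      by (rule arg_cong[of _ _ "power _"], simp)+
    have ring: "x * (z * y * x * c) - z * y * (w * b + d) = (- y) * (z * w * b + (z * d - z * (x * x * c)))"
      for x y z w b c d :: "real fps"
      by (simp add: algebra_simps)
    show ?thesis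
      unfolding 1 2 3 V_def[of k] power2_eq_square by (rule ring)
  qed
  have "locfin (\<lambda>k. fps_X ^ (3 * k) * qbin k (k + m + 2) + (V k - V (Suc k)))"
    using S V by (simp add: locfin_def)
  note lm = lfs_mult[OF this]
  have "fps_X * rank_gf (m + 4) - rank_gf (m + 3) =
      (- (fps_X ^ (m + 4))) * lfs (\<lambda>k. fps_X ^ (3 * k) * qbin k (k + m + 2) + (V k - V (Suc k)))"
    unfolding rank_gf_def lfs_mult[OF locfin_rank_gf, symmetric] lfs_diff[symmetric] V_eq lm ..
  also have "lfs (\<lambda>k. fps_X ^ (3 * k) * qbin k (k + m + 2) + (V k - V (Suc k))) = S"
    unfolding lfs_add lfs_telescope[OF V] S_def by (simp add: V_def)
  finally have rhs: "fps_X * rank_gf (m + 4) - rank_gf (m + 3) = - (fps_X ^ (m + 4)) * S" .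
  have "2 * m + 6 = (m + 2) + (m + 4)" by simp
  then show ?thesis
    unfolding lhs rhs by (simp only: power_add mult_minus_left mult_minus_right mult.assoc)
qed

definition rank_ge :: "nat \<Rightarrow> real fps" where
  "rank_ge r = lfs (\<lambda>s. rank_gf (r + s))"

lemma locfin_rank_ge: "locfin (\<lambda>s. rank_gf (r + s))"
  by (simp add: locfin_def rank_gf_nth_0)

lemma rank_gf_eq: "rank_gf r = rank_ge r - rank_ge (Suc r)"
  unfolding rank_ge_def by (subst lfs_Suc[OF locfin_rank_ge]) simp

lemma rank_ge_nth_0: "n \<le> r \<Longrightarrow> rank_ge r $ n = 0"
  by (simp add: rank_ge_def lfs_def rank_gf_nth_0)

text \<open>Summing \<open>rank_gf_rec\<close> over all indices from \<open>r\<close> on makes its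
  right-hand side telescope. Repeated use shows that the combination is \<open>fps_X ^ r\<close>
  times a fixed series.\<close>

lemma rank_ge_rec:
  "fps_X * (rank_ge r + fps_X ^ (r + 1) * rank_ge (r + 3)) =
   rank_ge (Suc r) + fps_X ^ (Suc r + 1) * rank_ge (Suc r + 3)"
proof -
  define U where "U s = fps_X ^ (r + s + 2) * rank_gf (r + s + 3)" for s
  have U: "locfin U"
    unfolding U_def by (rule locfin_shift) simp
  have eq: "fps_X * rank_gf (r + s) - rank_gf (Suc r + s) = - (U s - U (Suc s))" for s
  proof -
    have 1: "Suc r + s = r + s + 1" "r + Suc s = r + s + 1" by simp_all
    have 2: "fps_X ^ (r + s + 1 + 2) = fps_X ^ (r + s + 2) * (fps_X :: real fps)"
      unfolding power_Suc2[symmetric] by (rule arg_cong[of _ _ "power _"]) simp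
    have 3: "r + s + 1 + 3 = r + s + 4" by simp
    show ?thesis
      unfolding U_def 1 2 3 rank_gf_rec[of "r + s"] by (simp only: right_diff_distrib mult.assoc minus_diff_eq)
  qed
  have "fps_X * rank_ge r - rank_ge (Suc r) = - (fps_X ^ (r + 2) * rank_gf (r + 3))"
    unfolding rank_ge_def lfs_mult[OF locfin_rank_ge, symmetric] lfs_diff[symmetric] eq lfs_uminus
      lfs_telescope[OF U] by (simp add: U_def)
  also have "rank_gf (r + 3) = rank_ge (r + 3) - rank_ge (r + 4)"
    using rank_gf_eq[of "r + 3"] by (simp add: eval_nat_numeral)
  finally have 1: "fps_X * rank_ge r = rank_ge (Suc r) - fps_X ^ (r + 2) * (rank_ge (r + 3) - rank_ge (r + 4))"
    by (simp add: algebra_simps)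
  have 2: "fps_X ^ (r + 2) = fps_X * (fps_X ^ (r + 1) :: real fps)" "Suc r + 1 = r + 2" "Suc r + 3 = r + 4"
    by simp_all
  show ?thesis
    unfolding distrib_left 1 2 by (simp add: algebra_simps)
qed

section \<open>Stable coefficients and the limit of the rank tails\<close>

lemma qinv_nth_eq: "t \<le> m \<Longrightarrow> qinv m $ t = qinv t $ t"
proof (induction m rule: dec_induct)
  case (step m)
  have "qinv m $ t = qinv (Suc m) $ t - (fps_X ^ Suc m * qinv (Suc m)) $ t"
    by (subst qinv_eq) (simp only: left_diff_distrib mult_1_left fps_sub_nth)
  also have "(fps_X ^ Suc m * qinv (Suc m)) $ t = 0"
    unfolding fps_X_power_mult_nth using step by simp
  finally show ?case using step by simp
qed simp

text \<open>As \<open>durfee_gf r\<close> does not depend on \<open>r\<close>, one may take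
  \<open>r = Suc t\<close>; then only the term \<open>k = 0\<close> reaches degree \<open>t\<close>.
  This justifies reading \<open>durfee_gf 0\<close> as \<open>P\<close>.\<close>

lemma durfee_gf_nth: "durfee_gf 0 $ t = qinv t $ t"
proof -
  have "durfee_gf 0 $ t = durfee_gf (Suc t) $ t"
    by (simp only: durfee_gf_eq[of "Suc t"])
  also have "\<dots> = (\<Sum>k\<le>t. if k = 0 then qinv (Suc t) $ t else 0)"
    unfolding durfee_gf_def lfs_def fps_nth_Abs_fps fps_X_power_mult_nth
  proof (intro sum.cong refl)
    fix k
    have "k \<noteq> 0 \<Longrightarrow> t < k * (k + Suc t)"
      by (cases k) auto
    then show "(if t < k * (k + Suc t) then 0 else (qinv k * qinv (k + Suc t)) $ (t - k * (k + Suc t))) =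
        (if k = 0 then qinv (Suc t) $ t else 0)"
      by (auto simp: qinv_0)
  qed
  also have "\<dots> = qinv t $ t"
    by (simp add: qinv_nth_eq[of t "Suc t"])
  finally show ?thesis .
qed

lemma sum_power_qinv: "(\<Sum>k\<le>m. fps_X ^ k * qinv k) = qinv m"
proof (induction m)
  case (Suc m)
  then show ?case
    unfolding sum.atMost_Suc Suc.IH qinv_eq[of m] by (simp only: left_diff_distrib mult_1_left diff_add_cancel)
qed (simp add: qinv_0)

lemma lfs_power_qinv: "lfs (\<lambda>k. fps_X ^ k * qinv k) = durfee_gf 0"
proof (rule fps_ext)
  fix n
  have "lfs (\<lambda>k. fps_X ^ k * qinv k) $ n = (\<Sum>k\<le>n. fps_X ^ k * qinv k) $ n"
    by (simp only: lfs_def fps_nth_Abs_fps fps_sum_nth)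
  then show "lfs (\<lambda>k. fps_X ^ k * qinv k) $ n = durfee_gf 0 $ n"
    by (simp only: sum_power_qinv durfee_gf_nth)
qed

text \<open>Writing one factor \<open>fps_X ^ k\<close> as \<open>1 - (1 - fps_X ^ k)\<close> leaves
  the previous sum minus its own shift.\<close>

lemma lfs_power_double_qinv: "lfs (\<lambda>k. fps_X ^ (2 * k) * qinv k) = (1 - fps_X) * durfee_gf 0"
proof -
  have l1: "locfin (\<lambda>k. fps_X ^ k * ((1 - fps_X ^ k) * qinv k))"
    and l2: "locfin (\<lambda>k. fps_X ^ k * qinv k)"
    by (rule locfin_shift, simp)+
  have 1: "fps_X ^ (2 * k) * qinv k = fps_X ^ k * qinv k - fps_X ^ k * ((1 - fps_X ^ k) * qinv k)" for k
    unfolding mult_2 power_add by (simp add: algebra_simps)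
  have 2: "fps_X ^ Suc k * ((1 - fps_X ^ Suc k) * qinv (Suc k)) = fps_X * (fps_X ^ k * qinv k)" for k
    unfolding qinv_eq[symmetric] by simp
  show ?thesis
    unfolding 1 lfs_diff lfs_Suc[OF l1] 2 lfs_mult[OF l2] lfs_power_qinv by (simp add: algebra_simps)
qed

lemma lfs_power: "(1 - fps_X) * lfs (\<lambda>s. fps_X ^ s) = 1"
proof -
  have l: "locfin (\<lambda>s. fps_X ^ s)"
    by (simp add: locfin_def)
  have 1: "(1 - fps_X) * fps_X ^ s = fps_X ^ s - (fps_X ^ Suc s :: real fps)" for s
    by (simp add: algebra_simps)
  show ?thesis
    unfolding lfs_mult[OF l, symmetric] 1 lfs_telescope[OF l] by simp
qed

text \<open>Only factors \<open>1 - fps_X ^ i\<close> with \<open>b < i\<close> survive, and these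
  do not affect degrees up to \<open>b\<close>.\<close>

lemma qpoch_add_qinv_nth: "i \<le> b \<Longrightarrow> (qpoch (k + b) * qinv b) $ i = 1 $ i"
proof (induction k)
  case 0
  then show ?case by (simp add: qpoch_qinv)
next
  case (Suc k)
  have "qpoch (Suc k + b) * qinv b =
      qpoch (k + b) * qinv b - fps_X ^ Suc (k + b) * (qpoch (k + b) * qinv b)"
    by (simp add: qpoch_Suc algebra_simps)
  then have "(qpoch (Suc k + b) * qinv b) $ i =
      (qpoch (k + b) * qinv b) $ i - (fps_X ^ Suc (k + b) * (qpoch (k + b) * qinv b)) $ i"
    by (simp only: fps_sub_nth)
  also have "(fps_X ^ Suc (k + b) * (qpoch (k + b) * qinv b)) $ i = 0"
    unfolding fps_X_power_mult_nth using Suc.prems by simp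
  finally show ?case using Suc by simp
qed

lemma qbin_nth: "i \<le> b \<Longrightarrow> qbin k b $ i = qinv k $ i"
proof -
  assume "i \<le> b"
  have "qbin k b $ i = (qinv k * (qpoch (k + b) * qinv b)) $ i"
    by (simp add: qbin_def mult_ac)
  also have "\<dots> = (qinv k * 1) $ i"
    unfolding fps_mult_nth[of "qinv k"] using \<open>i \<le> b\<close>
    by (intro sum.cong refl) (subst qpoch_add_qinv_nth, simp_all)
  finally show ?thesis by simp
qed

text \<open>Identifies the constant in \<open>rank_ge_rec\<close> as \<open>P\<close>, by letting \<open>r\<close> grow.\<close>
lemma rank_ge_nth_large:
  assumes "t \<le> r"
  shows "rank_ge r $ (r + 1 + t) = durfee_gf 0 $ t"
proof -
  define L where "L s = lfs (\<lambda>k. fps_X ^ (2 * k) * qbin k (k + (r + s)))" for s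
  define G where "G = lfs (\<lambda>k. fps_X ^ (2 * k) * qinv k)"
  have l1: "locfin (\<lambda>k. fps_X ^ (2 * k) * qbin k (k + (r + s)))" for s
    by (rule locfin_shift) simp
  have l2: "locfin (\<lambda>s. fps_X ^ s * L s)" and l3: "locfin (\<lambda>s. fps_X ^ s)"
    by (rule locfin_shift, simp) (simp add: locfin_def)
  have "rank_gf (r + s) = fps_X ^ (r + 1) * (fps_X ^ s * L s)" for s
  proof -
    have 1: "2 * k + (r + s) + 1 = (r + 1) + s + 2 * k" for k by simp
    have 2: "fps_X ^ (r + 1) * (fps_X ^ s * g) = fps_X ^ (r + 1 + s) * g" for g :: "real fps"
      by (simp only: power_add mult.assoc)
    show ?thesis
      unfolding rank_gf_def L_def 1 2
      unfolding lfs_mult[OF l1, symmetric] mult.assoc[symmetric] power_add[symmetric] ..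
  qed
  then have "rank_ge r = fps_X ^ (r + 1) * lfs (\<lambda>s. fps_X ^ s * L s)"
    unfolding rank_ge_def lfs_mult[OF l2, symmetric] by presburger
  then have "rank_ge r $ (r + 1 + t) = lfs (\<lambda>s. fps_X ^ s * L s) $ t"
    by (simp only: fps_X_power_mult_nth) simp
  also have "\<dots> = lfs (\<lambda>s. fps_X ^ s * G) $ t"
  proof -
    \<comment> \<open>Up to degree \<open>r\<close> the Gaussian binomials agree with
      \<open>qinv k\<close>, since their second entry is at least \<open>r\<close>.\<close>
    have "L s $ i = G $ i" if "i \<le> r" for s i
      using that unfolding L_def G_def lfs_def fps_nth_Abs_fps fps_X_power_mult_nth
      by (intro sum.cong refl) (simp add: qbin_nth)
    then show ?thesis
      using assms unfolding lfs_def fps_nth_Abs_fps fps_X_power_mult_nth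
      by (intro sum.cong refl) simp
  qed
  \<comment> \<open>The geometric series over \<open>s\<close> cancels the factor
    \<open>1 - fps_X\<close> of \<open>G\<close>.\<close>
  also have "lfs (\<lambda>s. fps_X ^ s * G) = durfee_gf 0"
  proof -
    have "lfs (\<lambda>s. fps_X ^ s * G) = ((1 - fps_X) * lfs (\<lambda>s. fps_X ^ s)) * durfee_gf 0"
      unfolding mult.commute[of _ G] lfs_mult[OF l3] unfolding G_def lfs_power_double_qinv
      by (simp only: mult_ac)
    then show ?thesis by (simp add: lfs_power)
  qed
  finally show ?thesis .
qed

text \<open>Dyson's adjoint symmetry.\<close>
lemma rank_ge_eq: "rank_ge r + fps_X ^ (r + 1) * rank_ge (r + 3) = fps_X ^ (r + 1) * durfee_gf 0"
proof (rule fps_ext)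
  fix n
  define Z where "Z r = rank_ge r + fps_X ^ (r + 1) * rank_ge (r + 3)" for r
  have Z: "fps_X ^ s * Z r = Z (r + s)" for s
  proof (induction s)
    case (Suc s)
    have "fps_X ^ Suc s * Z r = fps_X * Z (r + s)"
      unfolding Suc.IH[symmetric] by (simp add: mult.assoc)
    also have "\<dots> = Z (r + Suc s)"
      unfolding Z_def rank_ge_rec by simp
    finally show ?case .
  qed simp
  show "(rank_ge r + fps_X ^ (r + 1) * rank_ge (r + 3)) $ n = (fps_X ^ (r + 1) * durfee_gf 0) $ n"
  proof (cases "n < r + 1")
    case True
    then show ?thesis
      by (simp only: fps_add_nth fps_X_power_mult_nth) (simp add: rank_ge_nth_0)
  next
    case False
    then obtain t where n: "n = r + 1 + t"
      by (metis le_Suc_ex not_less)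
    \<comment> \<open>Multiplying by \<open>fps_X ^ t\<close> moves to index \<open>r + t\<close>,
      large enough for \<open>rank_ge_nth_large\<close>, while the second tail vanishes in degree
      \<open>t\<close>.\<close>
    have "Z r $ n = (fps_X ^ t * Z r) $ (n + t)"
      by (simp only: fps_X_power_mult_nth) simp
    also have "\<dots> = rank_ge (r + t) $ ((r + t) + 1 + t) + rank_ge (r + t + 3) $ t"
      unfolding Z unfolding Z_def n fps_add_nth fps_X_power_mult_nth by (simp add: add_ac)
    also have "\<dots> = durfee_gf 0 $ t"
      by (subst rank_ge_nth_large) (simp_all add: rank_ge_nth_0)
    also have "\<dots> = (fps_X ^ (r + 1) * durfee_gf 0) $ n"
      unfolding n fps_X_power_mult_nth by simp
    finally show ?thesis by (simp only: Z_def)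
  qed
qed

section \<open>Nonnegativity of the spt-crank series\<close>

text \<open>Remainder after \<open>i\<close> steps of unfolding the recurrences of \<open>F\<close> and \<open>R\<close>;
  \<open>spt_gf j 0\<close> is \<open>\<Sum>r>j. F\<^sub>r - R\<^sub>r\<close>.\<close>
definition spt_gf :: "nat \<Rightarrow> nat \<Rightarrow> real fps" where
  "spt_gf j i = lfs (\<lambda>s. fps_X ^ (i * (j + i + 1 + s)) *
     (crank_ge (j + 2 * i + 1 + s) - rank_ge (j + 3 * i + 1 + s)))"

lemma crank_ge_nth_0: "n < r \<Longrightarrow> crank_ge r $ n = 0"
  by (simp add: crank_ge_eq_crank_le fps_X_power_mult_nth)

text \<open>Both recurrences are applied once inside the sum. Replacing \<open>P\<close> by
  \<open>crank_ge (b + 2) + crank_le (b + 1)\<close> produces the next remainder and a telescoping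
  difference of \<open>Y\<close>, of which only \<open>Y 0\<close> survives.\<close>

lemma spt_gf_rec:
  "spt_gf j i = fps_X ^ i * (fps_X ^ ((i + 1) * (j + i + 1)) * crank_le (j + 2 * i + 1) - spt_gf j (i + 1))"
proof -
  define T where "T i s = fps_X ^ (i * (j + i + 1 + s)) *
     (crank_ge (j + 2 * i + 1 + s) - rank_ge (j + 3 * i + 1 + s))" for i s
  define Y where "Y s = fps_X ^ ((i + 1) * (j + i + 1 + s)) * crank_le (j + 2 * i + 1 + s)" for s
  have T: "locfin (T i)" for i
    unfolding locfin_def T_def by (simp add: fps_X_power_mult_nth crank_ge_nth_0 rank_ge_nth_0)
  have Y: "locfin Y"
    unfolding Y_def by (rule locfin_shift) simp
  have "T i = (\<lambda>s. fps_X ^ i * ((Y s - Y (Suc s)) - T (i + 1) s))"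
  proof
    fix s
    \<comment> \<open>Since \<open>b = a + i\<close> and \<open>c = a + 2 * i\<close>, the exponents
      in \<open>e1\<close> and \<open>e2\<close> share the factor \<open>fps_X ^ i\<close>.\<close>
    define a b c where "a = j + i + 1 + s" and "b = j + 2 * i + 1 + s" and "c = j + 3 * i + 1 + s"
    have 1: "j + (i + 1) + 1 + s = a + 1" "j + i + 1 + Suc s = a + 1"
      "j + 2 * (i + 1) + 1 + s = Suc (Suc b)" "j + 2 * i + 1 + Suc s = Suc b"
      "j + 3 * (i + 1) + 1 + s = c + 3"
      by (simp_all add: a_def b_def c_def)
    have 2: "crank_ge (Suc (Suc b)) = durfee_gf 0 - crank_le (Suc b)"
      using crank_ge_plus_crank_le[of "Suc b"] by (simp add: algebra_simps)
    have 3: "rank_ge c = fps_X ^ (c + 1) * (durfee_gf 0 - rank_ge (c + 3))"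
      using rank_ge_eq[of c] by (simp add: algebra_simps)
    have e1: "fps_X ^ (i * a) * fps_X ^ b = fps_X ^ i * (fps_X ^ ((i + 1) * a) :: real fps)"
      unfolding power_add[symmetric]
      by (rule arg_cong[of _ _ "power _"]) (simp add: a_def b_def algebra_simps)
    have e2: "fps_X ^ (i * a) * fps_X ^ (c + 1) = fps_X ^ i * (fps_X ^ ((i + 1) * (a + 1)) :: real fps)"
      unfolding power_add[symmetric]
      by (rule arg_cong[of _ _ "power _"]) (simp add: a_def c_def algebra_simps)
    have "T i s = fps_X ^ (i * a) * fps_X ^ b * crank_le b -
        fps_X ^ (i * a) * fps_X ^ (c + 1) * (durfee_gf 0 - rank_ge (c + 3))"
      unfolding T_def a_def[symmetric] b_def[symmetric] c_def[symmetric] crank_ge_eq_crank_le 3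
      by (simp only: right_diff_distrib mult.assoc)
    also have "\<dots> = fps_X ^ i * ((fps_X ^ ((i + 1) * a) * crank_le b -
        fps_X ^ ((i + 1) * (a + 1)) * crank_le (Suc b)) -
        fps_X ^ ((i + 1) * (a + 1)) * (crank_ge (Suc (Suc b)) - rank_ge (c + 3)))"
      unfolding e1 e2 2 by (simp only: right_diff_distrib mult.assoc) simp
    finally show "T i s = fps_X ^ i * ((Y s - Y (Suc s)) - T (i + 1) s)"
      unfolding Y_def T_def[of "i + 1"] 1 a_def[symmetric] b_def[symmetric] .
  qed
  moreover have "locfin (\<lambda>s. (Y s - Y (Suc s)) - T (i + 1) s)"
    using Y T[of "i + 1"] by (simp add: locfin_def)
  note lm = lfs_mult[OF this]
  ultimately have "lfs (T i) = fps_X ^ i * (lfs (\<lambda>s. Y s - Y (Suc s)) - lfs (T (i + 1)))"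
    by (simp only: lm) (simp only: lfs_diff)
  moreover have "spt_gf j i = lfs (T i)" for i
    unfolding spt_gf_def by (intro arg_cong[of _ _ lfs] ext) (simp only: T_def)
  moreover have "Y 0 = fps_X ^ ((i + 1) * (j + i + 1)) * crank_le (j + 2 * i + 1)"
    by (simp only: Y_def add_0_right)
  ultimately show ?thesis
    by (simp only: lfs_telescope[OF Y])
qed

text \<open>Raising the exponent in \<open>crank_le_diff\<close> by \<open>i\<close> adds a multiple
  of \<open>(1 - fps_X ^ i) * crank_le (r + 2)\<close>, which is nonnegative.\<close>

lemma nonneg_coeffs_crank_le_diff:
  assumes "i \<le> r + 2"
  shows "nonneg_coeffs (crank_le r - fps_X ^ (r + 3 + i) * crank_le (r + 2) - qinv r)"
proof -
  have "crank_le r - fps_X ^ (r + 3 + i) * crank_le (r + 2) - qinv r =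
      (crank_le r - fps_X ^ (r + 3) * crank_le (r + 2) - qinv r) +
      fps_X ^ (r + 3) * ((1 - fps_X ^ i) * crank_le (r + 2))"
    unfolding power_add[of _ _ i] by (simp add: algebra_simps)
  also have "nonneg_coeffs \<dots>"
    using assms by (intro nonneg_coeffs_add nonneg_coeffs_mult nonneg_coeffs_fps_X_power
        crank_le_diff nonneg_coeffs_mult_crank_le)
  finally show ?thesis .
qed

text \<open>Two unfoldings pair consecutive terms of opposite sign and return the remainder with a
  plus sign. The \<open>qinv\<close> term is kept apart from \<open>g\<close> to give strictness
  later.\<close>

lemma spt_gf_rec2:
  "\<exists>g. nonneg_coeffs g \<and> spt_gf j i =
     fps_X ^ (i + (i + 1) * (j + i + 1)) * (qinv (j + 2 * i + 1) + g) + fps_X ^ (2 * i + 1) * spt_gf j (i + 2)"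
proof -
  define r where "r = j + 2 * i + 1"
  define g where "g = crank_le r - fps_X ^ (r + 3 + i) * crank_le (r + 2) - qinv r"
  have e: "fps_X ^ i * (fps_X ^ (i + 1) * fps_X ^ ((i + 1 + 1) * (j + (i + 1) + 1))) =
      fps_X ^ i * fps_X ^ ((i + 1) * (j + i + 1)) * (fps_X ^ (r + 3 + i) :: real fps)"
    unfolding power_add[symmetric]
    by (rule arg_cong[of _ _ "power _"]) (simp add: r_def algebra_simps)
  have r: "j + 2 * (i + 1) + 1 = r + 2" "i + 1 + 1 = i + 2"
    by (simp_all add: r_def)
  have "spt_gf j i = fps_X ^ i * fps_X ^ ((i + 1) * (j + i + 1)) * crank_le r -
      fps_X ^ i * (fps_X ^ (i + 1) * fps_X ^ ((i + 1 + 1) * (j + (i + 1) + 1))) * crank_le (r + 2) +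
      fps_X ^ i * fps_X ^ (i + 1) * spt_gf j (i + 2)"
    unfolding spt_gf_rec[of j i] spt_gf_rec[of j "i + 1"] r_def[symmetric] r
    by (simp only: right_diff_distrib mult.assoc) simp
  also have "\<dots> = fps_X ^ (i + (i + 1) * (j + i + 1)) * (qinv r + g) + fps_X ^ (2 * i + 1) * spt_gf j (i + 2)"
  proof -
    have "2 * i + 1 = i + (i + 1)" by simp
    then show ?thesis
      unfolding e g_def by (simp only: power_add[of _ i]) (simp add: algebra_simps)
  qed
  finally show ?thesis
    using nonneg_coeffs_crank_le_diff[of i r] by (auto simp: g_def r_def)
qed

text \<open>The factor \<open>fps_X ^ (2 * i + 1)\<close> lowers the degree of the remainder, so
  induction on the degree, with \<open>i\<close> varying, replaces an infinite unfolding.\<close>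

lemma spt_gf_nonneg: "0 \<le> spt_gf j i $ n"
proof (induction n arbitrary: i rule: less_induct)
  case (less n)
  obtain g where g: "nonneg_coeffs g" and eq: "spt_gf j i =
     fps_X ^ (i + (i + 1) * (j + i + 1)) * (qinv (j + 2 * i + 1) + g) + fps_X ^ (2 * i + 1) * spt_gf j (i + 2)"
    using spt_gf_rec2 by blast
  have "nonneg_coeffs (fps_X ^ (i + (i + 1) * (j + i + 1)) * (qinv (j + 2 * i + 1) + g))"
    by (intro nonneg_coeffs_mult nonneg_coeffs_add nonneg_coeffs_fps_X_power nonneg_coeffs_qinv g)
  moreover have "0 \<le> (fps_X ^ (2 * i + 1) * spt_gf j (i + 2)) $ n"
    unfolding fps_X_power_mult_nth using less.IH by simp
  ultimately show ?case
    unfolding eq by (simp add: nonneg_coeffs_def)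
qed

lemma spt_gf_0_pos:
  assumes "1 \<le> n"
  shows "1 \<le> spt_gf 0 0 $ n"
proof -
  obtain g where g: "nonneg_coeffs g"
    and eq: "spt_gf 0 0 = fps_X ^ 1 * (qinv 1 + g) + fps_X ^ 1 * spt_gf 0 2"
    using spt_gf_rec2[of 0 0] by (auto simp: numeral_2_eq_2)
  have "qinv 1 $ m = 1" for m
    using inverse_one_minus_power[of 1] by (simp add: qinv_def qpoch_def)
  then have "1 \<le> (fps_X ^ 1 * (qinv 1 + g)) $ n"
    using assms g by (simp add: fps_X_power_mult_nth nonneg_coeffs_def)
  moreover have "0 \<le> (fps_X ^ 1 * spt_gf 0 2) $ n"
    unfolding fps_X_power_mult_nth by (simp add: spt_gf_nonneg)
  ultimately show ?thesis
    unfolding eq by simp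
qed

lemma spt_gf_nth: "spt_gf j 0 $ n = (\<Sum>r=Suc j..n. crank_ge r $ n - rank_ge r $ n)"
proof -
  have "spt_gf j 0 $ n = (\<Sum>s\<le>n. crank_ge (s + Suc j) $ n - rank_ge (s + Suc j) $ n)"
    by (simp add: spt_gf_def lfs_def add_ac)
  also have "\<dots> = (\<Sum>r=0+Suc j..n+Suc j. crank_ge r $ n - rank_ge r $ n)"
    unfolding sum.shift_bounds_cl_nat_ivl atMost_atLeast0 ..
  also have "\<dots> = (\<Sum>r=Suc j..n. crank_ge r $ n - rank_ge r $ n)"
    by (rule sum.mono_neutral_right) (auto simp: crank_ge_nth_0 rank_ge_nth_0)
  finally show ?thesis .
qed

section \<open>Generating functions of classes of partitions\<close>

definition gf :: "nat multiset set \<Rightarrow> real fps" where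
  "gf C = Abs_fps (\<lambda>n. real (card {p \<in> C. sum_mset p = n}))"

text \<open>Zero parts could make a class infinite at a fixed sum, where \<open>card\<close> is 0;
  excluding them keeps every coefficient of \<open>gf\<close> a true count.\<close>

abbreviation pos_parts :: "nat multiset set \<Rightarrow> bool" where
  "pos_parts C \<equiv> \<forall>p\<in>C. 0 \<notin># p"

lemma size_le_sum_mset: "0 \<notin># p \<Longrightarrow> size p \<le> sum_mset p" for p :: "nat multiset"
  by (induction p) auto

lemma finite_multisets_of_sum: "finite {p :: nat multiset. 0 \<notin># p \<and> sum_mset p = n}"
proof (rule finite_subset)
  show "{p. 0 \<notin># p \<and> sum_mset p = n} \<subseteq> mset ` {xs. set xs \<subseteq> {..n} \<and> length xs \<le> n}"
  proof
    fix p assume p: "p \<in> {p. 0 \<notin># p \<and> sum_mset p = n}"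
    obtain xs where xs: "mset xs = p"
      using ex_mset by blast
    have "x \<le> n" if "x \<in># p" for x
      using p multi_member_split[OF that] by auto
    moreover have "size p \<le> n"
      using p size_le_sum_mset by auto
    ultimately show "p \<in> mset ` {xs. set xs \<subseteq> {..n} \<and> length xs \<le> n}"
      using xs by (intro image_eqI[of _ _ xs]) auto
  qed
qed (simp add: finite_lists_length_le)

lemma finite_pos_parts: "pos_parts C \<Longrightarrow> finite {p \<in> C. sum_mset p = n}"
  by (rule finite_subset[OF _ finite_multisets_of_sum[of n]]) auto

lemma gf_nth: "gf C $ n = real (card {p \<in> C. sum_mset p = n})"
  by (simp add: gf_def)

lemma gf_Un:
  assumes "pos_parts C" "pos_parts D" "C \<inter> D = {}"
  shows "gf (C \<union> D) = gf C + gf D"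
proof (rule fps_ext)
  fix n
  have "{p \<in> C \<union> D. sum_mset p = n} = {p \<in> C. sum_mset p = n} \<union> {p \<in> D. sum_mset p = n}"
    by auto
  moreover have "{p \<in> C. sum_mset p = n} \<inter> {p \<in> D. sum_mset p = n} = {}"
    using assms(3) by auto
  ultimately show "gf (C \<union> D) $ n = (gf C + gf D) $ n"
    by (simp add: gf_nth card_Un_disjoint finite_pos_parts assms(1,2))
qed

lemma gf_image:
  assumes "inj_on f C" "\<And>p. p \<in> C \<Longrightarrow> sum_mset (f p) = s + sum_mset p"
  shows "gf (f ` C) = fps_X ^ s * gf C"
proof (rule fps_ext)
  fix n
  show "gf (f ` C) $ n = (fps_X ^ s * gf C) $ n"
  proof (cases "n < s")
    case True
    then have "{p \<in> f ` C. sum_mset p = n} = {}"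
      using assms(2) by auto
    then show ?thesis
      using True by (simp only: gf_nth fps_X_power_mult_nth) simp
  next
    case False
    then have "{p \<in> f ` C. sum_mset p = n} = f ` {p \<in> C. sum_mset p = n - s}"
      using assms(2) by auto
    moreover have "inj_on f {p \<in> C. sum_mset p = n - s}"
      using assms(1) by (rule inj_on_subset) auto
    ultimately show ?thesis
      using False by (simp add: gf_nth fps_X_power_mult_nth card_image)
  qed
qed

lemma gf_add_mset: "gf (add_mset a ` C) = fps_X ^ a * gf C"
  by (rule gf_image) (auto simp: inj_on_def)

lemma gf_plus:
  assumes "pos_parts C" "pos_parts D" and inj: "inj_on (\<lambda>(p, q). p + q) (C \<times> D)"
  shows "gf ((\<lambda>(p, q). p + q) ` (C \<times> D)) = gf C * gf D"
proof (rule fps_ext)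
  fix n
  define A where "A i = {p \<in> C. sum_mset p = i} \<times> {p \<in> D. sum_mset p = n - i}" for i
  have "{r \<in> (\<lambda>(p, q). p + q) ` (C \<times> D). sum_mset r = n} = (\<lambda>(p, q). p + q) ` (\<Union>i\<in>{0..n}. A i)"
    by (force simp: A_def)
  moreover have "inj_on (\<lambda>(p, q). p + q) (\<Union>i\<in>{0..n}. A i)"
    using inj by (rule inj_on_subset) (auto simp: A_def)
  ultimately have "gf ((\<lambda>(p, q). p + q) ` (C \<times> D)) $ n = real (card (\<Union>i\<in>{0..n}. A i))"
    by (simp add: gf_nth card_image)
  also have "card (\<Union>i\<in>{0..n}. A i) = (\<Sum>i=0..n. card (A i))"
    by (rule card_UN_disjoint) (auto simp: A_def finite_pos_parts assms(1,2))
  finally show "gf ((\<lambda>(p, q). p + q) ` (C \<times> D)) $ n = (gf C * gf D) $ n"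
    by (simp add: A_def fps_mult_nth gf_nth card_cartesian_product)
qed

lemma gf_UN:
  assumes "\<And>k. pos_parts (D k)" "\<And>k l. k \<noteq> l \<Longrightarrow> D k \<inter> D l = {}"
    and le: "\<And>k p. p \<in> D k \<Longrightarrow> k \<le> sum_mset p"
  shows "gf (\<Union>k. D k) = lfs (\<lambda>k. gf (D k))"
proof (rule fps_ext)
  fix n
  have "{p \<in> \<Union>k. D k. sum_mset p = n} = (\<Union>k\<in>{..n}. {p \<in> D k. sum_mset p = n})"
    using le by auto
  moreover have "card (\<Union>k\<in>{..n}. {p \<in> D k. sum_mset p = n}) = (\<Sum>k\<le>n. card {p \<in> D k. sum_mset p = n})"
    using assms(2) by (intro card_UN_disjoint) (auto simp: finite_pos_parts assms(1))
  ultimately show "gf (\<Union>k. D k) $ n = lfs (\<lambda>k. gf (D k)) $ n"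
    by (simp add: lfs_def gf_nth)
qed

lemma one_minus_X_power_cancel:
  "(1 - fps_X ^ Suc k) * f = (1 - fps_X ^ Suc k) * g \<Longrightarrow> f = (g :: real fps)"
proof -
  have "(1 - fps_X ^ Suc k :: real fps) $ 0 \<noteq> 0" by simp
  then have "(1 - fps_X ^ Suc k :: real fps) \<noteq> 0" by (metis fps_zero_nth)
  then show "(1 - fps_X ^ Suc k) * f = (1 - fps_X ^ Suc k) * g \<Longrightarrow> f = g"
    by (metis mult_left_cancel)
qed

text \<open>Either \<open>a\<close> does not occur, or one copy of it can be removed.\<close>

lemma gf_parts_insert:
  assumes "a \<notin> S" "0 \<notin> insert a S"
  shows "(1 - fps_X ^ a) * gf {p. set_mset p \<subseteq> insert a S} = gf {p. set_mset p \<subseteq> S}"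
proof -
  let ?C = "\<lambda>S. {p. set_mset p \<subseteq> S}"
  have "p \<in> ?C S \<union> add_mset a ` ?C (insert a S)" if "p \<in> ?C (insert a S)" for p
  proof (cases "a \<in># p")
    case True
    then obtain p' where "p = add_mset a p'" by (metis multi_member_split)
    with that show ?thesis by auto
  qed (use that in auto)
  then have "?C (insert a S) = ?C S \<union> add_mset a ` ?C (insert a S)" by auto
  moreover have "gf (?C S \<union> add_mset a ` ?C (insert a S)) = gf (?C S) + gf (add_mset a ` ?C (insert a S))"
    by (rule gf_Un) (use assms in auto)
  ultimately have "gf (?C (insert a S)) = gf (?C S) + fps_X ^ a * gf (?C (insert a S))"
    by (simp only: gf_add_mset)
  then show ?thesis by (simp add: algebra_simps)
qed

lemma gf_single: "gf {p} = fps_X ^ sum_mset p"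
  by (rule fps_ext) (auto simp: gf_nth Collect_conv_if)

lemma gf_parts_from_1: "gf {p. set_mset p \<subseteq> {1..w}} = qinv w"
proof (induction w)
  case 0
  have "{p. set_mset p \<subseteq> {1..0::nat}} = {{#}}" by auto
  then show ?case by (simp add: gf_single qinv_0)
next
  case (Suc w)
  have "{1..Suc w} = insert (Suc w) {1..w}" by auto
  then have "(1 - fps_X ^ Suc w) * gf {p. set_mset p \<subseteq> {1..Suc w}} = gf {p. set_mset p \<subseteq> {1..w}}"
    by (simp only:) (rule gf_parts_insert, auto)
  also note Suc
  finally have "(1 - fps_X ^ Suc w) * gf {p. set_mset p \<subseteq> {1..Suc w}} = qinv w" .
  then show ?case
    unfolding qinv_eq[of w] by (rule one_minus_X_power_cancel)
qed

lemma gf_parts_from_2: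
  assumes "1 \<le> w"
  shows "gf {p. set_mset p \<subseteq> {2..w}} = (1 - fps_X) * qinv w"
proof -
  have "{1..w} = insert 1 {2..w}" using assms by auto
  with gf_parts_insert[of 1 "{2..w}"] show ?thesis
    by (simp add: gf_parts_from_1[symmetric])
qed

section \<open>Partitions in a box and partitions with parts bounded below\<close>

definition box :: "nat \<Rightarrow> nat \<Rightarrow> nat multiset set" where
  "box a b = {p. set_mset p \<subseteq> {1..a} \<and> size p = b}"

lemma gf_box_Suc: "gf (box (Suc a) (Suc b)) = gf (box a (Suc b)) + fps_X ^ Suc a * gf (box (Suc a) b)"
proof -
  have "p \<in> box a (Suc b) \<union> add_mset (Suc a) ` box (Suc a) b" if "p \<in> box (Suc a) (Suc b)" for p
  proof (cases "Suc a \<in># p")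
    case True
    then obtain p' where "p = add_mset (Suc a) p'" by (metis multi_member_split)
    with that show ?thesis by (auto simp: box_def)
  next
    case False
    have "{1..Suc a} = insert (Suc a) {1..a}" by auto
    with that False show ?thesis by (auto simp: box_def)
  qed
  moreover have "box a (Suc b) \<union> add_mset (Suc a) ` box (Suc a) b \<subseteq> box (Suc a) (Suc b)"
    by (fastforce simp: box_def)
  ultimately have "box (Suc a) (Suc b) = box a (Suc b) \<union> add_mset (Suc a) ` box (Suc a) b"
    by blast
  moreover have "gf (box a (Suc b) \<union> add_mset (Suc a) ` box (Suc a) b) =
      gf (box a (Suc b)) + gf (add_mset (Suc a) ` box (Suc a) b)"
    by (rule gf_Un) (fastforce simp: box_def)+
  ultimately show ?thesis by (simp only: gf_add_mset)
qed

text \<open>Lowering all \<open>b\<close> parts by 1 accounts for \<open>fps_X ^ b\<close> and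
  leaves parts from 0 to \<open>a\<close>. The induction matches the removal of a largest allowed
  part with q-Pascal.\<close>

lemma gf_box: "gf (box (Suc a) b) = fps_X ^ b * qbin b a"
proof (induction a arbitrary: b)
  case 0
  show ?case
  proof (induction b)
    case 0
    have "box (Suc 0) 0 = {{#}}" by (auto simp: box_def)
    then show ?case by (simp add: gf_single qbin_0)
  next
    case (Suc b)
    have "box 0 (Suc b) = {}" by (auto simp: box_def)
    moreover have "gf {} = 0" by (rule fps_ext) (simp add: gf_nth)
    ultimately show ?case
      unfolding gf_box_Suc Suc by (simp add: qbin_commute[of _ 0] qbin_0)
  qed
next
  case (Suc a)
  note IH = Suc
  show ?case
  proof (induction b)
    case 0
    have "box (Suc (Suc a)) 0 = {{#}}" by (auto simp: box_def)
    then show ?case by (simp add: gf_single qbin_0)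
  next
    case (Suc b)
    show ?case
      unfolding gf_box_Suc[of "Suc a" b] Suc IH qbin_Suc_Suc by (simp add: algebra_simps)
  qed
qed

definition parts_ge :: "nat \<Rightarrow> nat \<Rightarrow> nat multiset set" where
  "parts_ge a b = {p. (\<forall>x\<in>#p. a \<le> x) \<and> size p = b}"

lemma parts_ge_Suc: "parts_ge (Suc a) b = image_mset Suc ` parts_ge a b"
proof -
  have "p \<in> image_mset Suc ` parts_ge a b" if "p \<in> parts_ge (Suc a) b" for p
  proof (rule image_eqI)
    have "image_mset Suc (image_mset (\<lambda>x. x - 1) p) = image_mset (\<lambda>x. x) p"
      unfolding multiset.map_comp using that
      by (intro image_mset_cong) (force simp: parts_ge_def)
    then show "p = image_mset Suc (image_mset (\<lambda>x. x - 1) p)" by simp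
    show "image_mset (\<lambda>x. x - 1) p \<in> parts_ge a b"
      using that by (force simp: parts_ge_def)
  qed
  then show ?thesis by (auto simp: parts_ge_def)
qed

text \<open>Either \<open>a\<close> occurs and one copy is removed, or all parts exceed
  \<open>a\<close> and can be lowered by 1. The second case returns the same class, so the equation
  is solved by cancelling \<open>1 - fps_X ^ Suc b\<close>.\<close>

lemma gf_parts_ge:
  assumes "1 \<le> a"
  shows "gf (parts_ge a b) = fps_X ^ (a * b) * qinv b"
proof (induction b)
  case 0
  have "parts_ge a 0 = {{#}}" by (auto simp: parts_ge_def)
  then show ?case by (simp add: gf_single qinv_0)
next
  case (Suc b)
  have "p \<in> parts_ge (Suc a) (Suc b) \<union> add_mset a ` parts_ge a b" if "p \<in> parts_ge a (Suc b)" for p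
  proof (cases "a \<in># p")
    case True
    then obtain p' where "p = add_mset a p'" by (metis multi_member_split)
    with that show ?thesis by (auto simp: parts_ge_def)
  next
    case False
    with that have "\<forall>x\<in>#p. Suc a \<le> x"
      by (metis (mono_tags, lifting) Suc_leI le_neq_implies_less mem_Collect_eq parts_ge_def)
    with that show ?thesis by (auto simp: parts_ge_def)
  qed
  moreover have "parts_ge (Suc a) (Suc b) \<union> add_mset a ` parts_ge a b \<subseteq> parts_ge a (Suc b)"
    by (auto simp: parts_ge_def)
  ultimately have "parts_ge a (Suc b) = parts_ge (Suc a) (Suc b) \<union> add_mset a ` parts_ge a b"
    by blast
  moreover have "gf (parts_ge (Suc a) (Suc b) \<union> add_mset a ` parts_ge a b) =
      gf (parts_ge (Suc a) (Suc b)) + gf (add_mset a ` parts_ge a b)"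
    by (rule gf_Un) (use assms in \<open>auto simp: parts_ge_def\<close>)
  moreover have "gf (parts_ge (Suc a) (Suc b)) = fps_X ^ Suc b * gf (parts_ge a (Suc b))"
    unfolding parts_ge_Suc
  proof (rule gf_image)
    show "inj_on (image_mset Suc) (parts_ge a (Suc b))"
      by (rule inj_on_subset[OF multiset.inj_map]) auto
    have "sum_mset (image_mset Suc p) = size p + sum_mset p" for p :: "nat multiset"
      by (induction p) auto
    then show "sum_mset (image_mset Suc p) = Suc b + sum_mset p" if "p \<in> parts_ge a (Suc b)" for p
      using that by (simp add: parts_ge_def)
  qed
  ultimately have "gf (parts_ge a (Suc b)) =
      fps_X ^ Suc b * gf (parts_ge a (Suc b)) + fps_X ^ a * (fps_X ^ (a * b) * qinv b)"
    by (simp only: gf_add_mset Suc)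
  then have "(1 - fps_X ^ Suc b) * gf (parts_ge a (Suc b)) = fps_X ^ a * (fps_X ^ (a * b) * qinv b)"
    by (metis add_diff_cancel_left' left_diff_distrib mult_1_left)
  also have "\<dots> = (1 - fps_X ^ Suc b) * (fps_X ^ (a * Suc b) * qinv (Suc b))"
    unfolding qinv_eq[of b] mult_Suc_right power_add by (simp only: mult_ac)
  finally show ?case by (rule one_minus_X_power_cancel)
qed

section \<open>Rank and crank generating functions\<close>

lemma gf_rank:
  assumes "1 \<le> m"
  shows "gf {p. 0 \<notin># p \<and> rank p = int m} = rank_gf m"
proof -
  \<comment> \<open>Removing one largest part from a partition of rank \<open>m\<close> with
    \<open>k + 1\<close> parts leaves \<open>k\<close> parts of size at most
    \<open>k + m + 1\<close>.\<close>
  define D where "D k = add_mset (k + m + 1) ` box (k + m + 1) k" for k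
  have D_pos: "pos_parts (D k)" for k
    by (fastforce simp: D_def box_def)
  have D_size: "size p = Suc k" if "p \<in> D k" for p k
    using that by (auto simp: D_def box_def)
  have "{p. 0 \<notin># p \<and> rank p = int m} = (\<Union>k. D k)"
  proof (intro equalityI subsetI)
    fix p assume p: "p \<in> {p. 0 \<notin># p \<and> rank p = int m}"
    \<comment> \<open>The empty partition has rank 0, which \<open>1 \<le> m\<close>
      excludes.\<close>
    then have ne: "p \<noteq> {#}"
      using assms by (auto simp: rank_def largest_part_def)
    define a where "a = Max (set_mset p)"
    have a: "a \<in># p" "\<And>x. x \<in># p \<Longrightarrow> x \<le> a"
      using ne by (auto simp: a_def)
    obtain p' where p': "p = add_mset a p'"
      using a(1) by (metis multi_member_split)
    have "int a = int m + int (size p)"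
      using p ne by (simp add: rank_def largest_part_def a_def)
    then have a_eq: "a = size p' + m + 1"
      by (simp add: p')
    have "x \<in> {1..a}" if "x \<in># p'" for x
      using p a(2)[of x] that p' by (cases x) auto
    then have "p' \<in> box a (size p')"
      by (auto simp: box_def)
    then show "p \<in> (\<Union>k. D k)"
      unfolding D_def p' a_eq by blast
  next
    fix p assume "p \<in> (\<Union>k. D k)"
    then obtain k where k: "p \<in> D k" by blast
    then obtain p' where p': "p = add_mset (k + m + 1) p'" "set_mset p' \<subseteq> {1..k + m + 1}" "size p' = k"
      by (auto simp: D_def box_def)
    have "Max (set_mset p) = k + m + 1"
      by (rule Max_eqI) (use p' in auto)
    then show "p \<in> {p. 0 \<notin># p \<and> rank p = int m}"
    proof -
      have "0 \<notin># p" using D_pos k by blast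
      moreover have "rank p = int m"
        unfolding rank_def largest_part_def \<open>Max (set_mset p) = k + m + 1\<close> using p'(1,3) by simp
      ultimately show ?thesis by simp
    qed
  qed
  moreover have "gf (\<Union>k. D k) = lfs (\<lambda>k. gf (D k))"
  proof (rule gf_UN)
    show "k \<le> sum_mset p" if "p \<in> D k" for k p
      using D_size[OF that] size_le_sum_mset[of p] D_pos[of k] that by force
    show "D k \<inter> D l = {}" if "k \<noteq> l" for k l
      using D_size[of _ k] D_size[of _ l] that by fastforce
  qed (rule D_pos)
  moreover have "gf (D k) = fps_X ^ (2 * k + m + 1) * qbin k (k + m)" for k
  proof -
    have "fps_X ^ (2 * k + m + 1) = fps_X ^ (k + m + 1) * (fps_X ^ k :: real fps)"
      unfolding power_add[symmetric] by (rule arg_cong[of _ _ "power _"]) simp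
    then show ?thesis
      unfolding D_def gf_add_mset using gf_box[of "k + m" k] by (simp only: mult.assoc) simp
  qed
  ultimately show ?thesis
    by (simp only: rank_gf_def)
qed

text \<open>The partition \<open>{#1#}\<close> has crank \<open>-1\<close>; counting it under crank 1 instead reproduces the
  convention \<open>M 1 1 = 1\<close>.\<close>
definition crank_class :: "nat \<Rightarrow> nat multiset set" where
  "crank_class m = {p. 0 \<notin># p \<and> p \<noteq> {#1#} \<and> crank p = int m} \<union> (if m = 1 then {{#1#}} else {})"

lemma gf_crank:
  assumes "1 \<le> m"
  shows "gf (crank_class m) = crank_gf m"
proof -
  \<comment> \<open>With \<open>w > 0\<close> ones, crank \<open>m\<close> means exactly
    \<open>m + w\<close> parts above \<open>w\<close>; the other parts different from 1 lie between
    2 and \<open>w\<close>.\<close>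
  define B where "B w = {p :: nat multiset. set_mset p \<subseteq> {2..w}} \<times> parts_ge (w + 1) (m + w)" for w
  \<comment> \<open>\<open>w\<close> is the number of ones, except that \<open>D 0\<close> is \<open>{{#1#}}\<close> when \<open>m = 1\<close>, in line with \<open>crank_class\<close>.\<close>
  define D where "D w = (if w = 0 then add_mset m ` {p. set_mset p \<subseteq> {2..m}}
    else (\<lambda>p. replicate_mset w 1 + p) ` ((\<lambda>(p, q). p + q) ` B w))" for w
  have D_E: "\<exists>r s. p = replicate_mset w 1 + (r + s) \<and> set_mset r \<subseteq> {2..w} \<and> (\<forall>x\<in>#s. w + 1 \<le> x) \<and> size s = m + w"
    if p: "p \<in> D w" "w \<noteq> 0" for p w
  proof -
    obtain r s where "(r, s) \<in> B w" "p = replicate_mset w 1 + (r + s)"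
      using p by (auto simp: D_def)
    then show ?thesis
      by (intro exI[of _ r] exI[of _ s]) (simp add: B_def parts_ge_def)
  qed
  have D_pos: "pos_parts (D w)" for w
  proof (cases "w = 0")
    case True
    then show ?thesis using assms by (auto simp: D_def)
  next
    case False
    show ?thesis
    proof
      fix p assume "p \<in> D w"
      from D_E[OF this False] obtain r s where p: "p = replicate_mset w 1 + (r + s)"
        "set_mset r \<subseteq> {2..w}" "\<forall>x\<in>#s. w + 1 \<le> x" by blast
      then have "0 \<notin># r" "0 \<notin># s" by auto
      then show "0 \<notin># p" using False by (simp add: p(1))
    qed
  qed
  have D_count: "count p 1 = w" if "p \<in> D w" "p \<noteq> {#1#}" for p w
  proof (cases "w = 0")
    case True
    with that(1) obtain p' where p': "p = add_mset m p'" "set_mset p' \<subseteq> {2..m}"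
      by (auto simp: D_def)
    have "p' = {#}" if "m = 1"
      using p'(2) that by auto
    with p' that(2) have "m \<noteq> 1" by auto
    moreover have "1 \<notin># p'" using p'(2) by auto
    ultimately show ?thesis
      using True p' by (auto simp: not_in_iff)
  next
    case False
    from D_E[OF that(1) False] obtain r s where p: "p = replicate_mset w 1 + (r + s)"
      "set_mset r \<subseteq> {2..w}" "\<forall>x\<in>#s. w + 1 \<le> x" by blast
    then have "1 \<notin># r" "1 \<notin># s" using False by auto
    then show ?thesis
      by (simp add: p(1) not_in_iff)
  qed
  have D_single: "{#1#} \<notin> D w" if "w \<noteq> 0" for w
  proof
    assume "{#1#} \<in> D w"
    from D_E[OF this that] obtain r s where
      p: "{#1 :: nat#} = replicate_mset w 1 + (r + s)" and s: "size s = m + w" by blast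
    from p have "size {#1 :: nat#} = size (replicate_mset w 1 + (r + s))" by (rule arg_cong)
    then have "1 = w + (size r + size s)" by simp
    with s that assms show False by simp
  qed
  have crank_D: "crank p = int m" if "p \<in> D w" "p \<noteq> {#1#}" for p w
  proof (cases "w = 0")
    case True
    with that(1) obtain p' where p': "p = add_mset m p'" "set_mset p' \<subseteq> {2..m}"
      by (auto simp: D_def)
    have "Max (set_mset p) = m"
      by (rule Max_eqI) (use p' in auto)
    then show ?thesis
      using D_count[OF that] True p'(1) by (simp add: crank_def largest_part_def)
  next
    case False
    from D_E[OF that(1) False] obtain r s where p: "p = replicate_mset w 1 + (r + s)"
      "set_mset r \<subseteq> {2..w}" "\<forall>x\<in>#s. w + 1 \<le> x" "size s = m + w" by blast
    have "filter_mset (\<lambda>x. x > w) (replicate_mset w 1) = {#}" "filter_mset (\<lambda>x. x > w) r = {#}"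
      using p(2) False by (auto simp: filter_mset_eq_conv)
    moreover have "filter_mset (\<lambda>x. x > w) s = s"
      using p(3) by (auto simp: filter_mset_eq_conv)
    ultimately have "size (filter_mset (\<lambda>x. x > w) p) = m + w"
      by (simp add: p(1,4))
    then show ?thesis
      using D_count[OF that] False by (simp add: crank_def)
  qed
  have "crank_class m = (\<Union>w. D w)"
  proof (intro equalityI subsetI)
    fix p assume p: "p \<in> crank_class m"
    show "p \<in> (\<Union>w. D w)"
    proof (cases "p = {#1#}")
      case True
      then have "m = 1 \<or> crank {#1#} = int m \<and> p \<noteq> {#1#}"
        using p by (auto simp: crank_class_def split: if_splits)
      with True have "p \<in> D 0"
        by (auto simp: D_def)
      then show ?thesis by blast
    next
      case False
      then have p0: "0 \<notin># p" and crank: "crank p = int m"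
        using p by (auto simp: crank_class_def split: if_splits)
      define w where "w = count p 1"
      show ?thesis
      proof (cases "w = 0")
        case True
        then have large: "int (largest_part p) = int m"
          using crank by (simp add: crank_def w_def)
        with assms have "p \<noteq> {#}" by (auto simp: largest_part_def)
        then have m: "m \<in># p" "\<And>x. x \<in># p \<Longrightarrow> x \<le> m"
          using large by (auto simp: largest_part_def)
        obtain p' where p': "p = add_mset m p'"
          using m(1) by (metis multi_member_split)
        have "x \<in> {2..m}" if "x \<in># p'" for x
        proof -
          have "x \<in># p" using that by (simp add: p')
          moreover have "1 \<notin># p" using True by (simp add: w_def not_in_iff)
          ultimately have "x \<noteq> 0" "x \<noteq> 1" "x \<le> m"
            using p0 m(2) by metis+
          then show ?thesis by auto
        qed
        then have "p \<in> D 0"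
          by (auto simp: D_def p')
        then show ?thesis by blast
      next
        case False
        define r s where "r = filter_mset (\<lambda>x. x \<noteq> 1 \<and> x \<le> w) p" and "s = filter_mset (\<lambda>x. x > w) p"
        have "p = replicate_mset w 1 + (r + s)"
          by (rule multiset_eqI) (use False in \<open>auto simp: r_def s_def w_def\<close>)
        moreover have "x \<in> {2..w}" if "x \<in># r" for x
        proof -
          have "x \<in># p" "x \<noteq> 1" "x \<le> w"
            using that by (simp_all add: r_def)
          moreover have "x \<noteq> 0"
            using \<open>x \<in># p\<close> p0 by metis
          ultimately show ?thesis by auto
        qed
        moreover have "int (size s) - int w = int m"
          using crank False unfolding crank_def w_def[symmetric] s_def Let_def by (simp only: if_False)
        then have "size s = m + w" by simp
        then have "s \<in> parts_ge (w + 1) (m + w)"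
          by (auto simp: parts_ge_def s_def)
        ultimately have "p = replicate_mset w 1 + (r + s)" and rs: "(r, s) \<in> B w"
          by (auto simp: B_def)
        moreover from rs have "r + s \<in> (\<lambda>(p, q). p + q) ` B w"
          by (rule image_eqI[rotated]) simp
        ultimately have "p \<in> D w"
          unfolding D_def using False by simp
        then show ?thesis by blast
      qed
    qed
  next
    fix p assume "p \<in> (\<Union>w. D w)"
    then obtain w where w: "p \<in> D w" by blast
    show "p \<in> crank_class m"
    proof (cases "p = {#1#}")
      case True
      with w D_single have "p \<in> D 0" by (cases "w = 0") auto
      then have "m = 1" using True by (auto simp: D_def)
      then show ?thesis by (simp add: crank_class_def True)
    next
      case False
      then show ?thesis
        using w D_pos[of w] crank_D[OF w] by (auto simp: crank_class_def)
    qed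
  qed
  moreover have "gf (\<Union>w. D w) = lfs (\<lambda>w. gf (D w))"
  proof (rule gf_UN)
    show "pos_parts (D k)" for k by (rule D_pos)
    show "D k \<inter> D l = {}" if "k \<noteq> l" for k l
    proof -
      \<comment> \<open>The number of ones determines the index, except for \<open>{#1#}\<close>,
        which can lie only in \<open>D 0\<close>.\<close>
      have False if "p \<in> D k" "p \<in> D l" for p
        using that \<open>k \<noteq> l\<close> D_count[of p k] D_count[of p l] D_single[of k] D_single[of l]
        by (cases "p = {#1#}") auto
      then show ?thesis by blast
    qed
    show "k \<le> sum_mset p" if "p \<in> D k" for k p
    proof (cases "k = 0")
      case False
      from D_E[OF that False] have "k \<le> size p" by auto
      also have "size p \<le> sum_mset p"
        using that D_pos[of k] by (intro size_le_sum_mset) auto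
      finally show ?thesis .
    qed simp
  qed
  moreover have "gf (D w) = fps_X ^ (w + (w + 1) * (w + m)) * ((1 - fps_X) * qinv w * qinv (w + m))" for w
  proof (cases "w = 0")
    case True
    then show ?thesis
      using gf_parts_from_2[OF assms] by (simp add: D_def gf_add_mset qinv_0)
  next
    case False
    \<comment> \<open>Cutting at \<open>w\<close> recovers both components from their sum.\<close>
    have "inj_on (\<lambda>(p, q). p + q) (B w)"
    proof (rule inj_onI, clarify)
      fix p q p' q' :: "nat multiset"
      assume B: "(p, q) \<in> B w" "(p', q') \<in> B w" and eq: "p + q = p' + q'"
      have "filter_mset (\<lambda>x. x \<le> w) (p + q) = p" if "(p, q) \<in> B w" for p q
      proof -
        have "filter_mset (\<lambda>x. x \<le> w) p = p" "filter_mset (\<lambda>x. x \<le> w) q = {#}"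
          using that by (auto simp: B_def parts_ge_def filter_mset_eq_conv)
        then show ?thesis by simp
      qed
      from this[OF B(1)] this[OF B(2)] eq have "p = p'" by simp
      with eq show "p = p' \<and> q = q'" by simp
    qed
    then have "gf ((\<lambda>(p, q). p + q) ` B w) =
        gf {p. set_mset p \<subseteq> {2..w}} * gf (parts_ge (w + 1) (m + w))"
      unfolding B_def by (rule gf_plus[rotated 2]) (auto simp: parts_ge_def)
    moreover have "gf (D w) = fps_X ^ w * gf ((\<lambda>(p, q). p + q) ` B w)"
      unfolding D_def using False by (simp only: if_False) (rule gf_image, auto simp: inj_on_def)
    moreover have "gf {p. set_mset p \<subseteq> {2..w}} = (1 - fps_X) * qinv w"
      using False by (intro gf_parts_from_2) simp
    moreover have "gf (parts_ge (w + 1) (m + w)) = fps_X ^ ((w + 1) * (w + m)) * qinv (w + m)"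
      using gf_parts_ge[of "w + 1" "w + m"] by (simp only: add.commute[of m w])
    moreover have "fps_X ^ (w + (w + 1) * (w + m)) = fps_X ^ w * (fps_X ^ ((w + 1) * (w + m)) :: real fps)"
      by (rule power_add)
    ultimately show ?thesis
      by (simp only: mult_ac)
  qed
  ultimately show ?thesis
    by (simp only: crank_gf_def)
qed

section \<open>Comparison of the moments\<close>

lemma N_eq: "1 \<le> m \<Longrightarrow> real_of_int (N (int m) n) = rank_gf m $ n"
proof -
  assume "1 \<le> m"
  have "{p \<in> partitions n. rank p = int m} = {p \<in> {p. 0 \<notin># p \<and> rank p = int m}. sum_mset p = n}"
    by (auto simp: partitions_def intro: gr0I)
  then show ?thesis
    by (simp add: N_def gf_rank[OF \<open>1 \<le> m\<close>, symmetric] gf_nth)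
qed

lemma M_eq:
  assumes "1 \<le> m" "1 \<le> n"
  shows "real_of_int (M (int m) n) = crank_gf m $ n"
proof -
  have "M (int m) n = int (card {p \<in> crank_class m. sum_mset p = n})"
  proof (cases "n = 1")
    case True
    \<comment> \<open>This is the only partition of 1, so the first part of
      \<open>crank_class\<close> contributes nothing in degree 1.\<close>
    have "p = {#1#}" if "0 \<notin># p" "sum_mset p = 1" for p :: "nat multiset"
    proof -
      have "size p \<noteq> 0" "size p \<le> 1"
        using that size_le_sum_mset[of p] by auto
      then have "size p = 1" by linarith
      then obtain x where "p = {#x#}"
        using size_1_singleton_mset by blast
      with that show ?thesis by simp
    qed
    then have "{p \<in> crank_class m. sum_mset p = 1} = (if m = 1 then {{#1#}} else {})"
      by (auto simp: crank_class_def)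
    then show ?thesis
      using True assms by (simp add: M_def)
  next
    case False
    then have "{p \<in> crank_class m. sum_mset p = n} = {p \<in> partitions n. crank p = int m}"
      using assms by (auto simp: crank_class_def partitions_def intro: gr0I)
    then show ?thesis
      using False by (simp add: M_def)
  qed
  then show ?thesis
    by (simp add: gf_crank[OF assms(1), symmetric] gf_nth)
qed

text \<open>Gives nonnegative second differences of \<open>m ^ k\<close>. The induction step leaves
  the surplus \<open>(x + 1) ^ k - (x - 1) ^ k\<close>.\<close>

lemma power_convex: "2 * x ^ k \<le> (x + 1) ^ k + (x - 1) ^ k" if "1 \<le> x" for x :: real
proof (induction k)
  case (Suc k)
  have "(x - 1) ^ k \<le> (x + 1) ^ k"
    using that by (intro power_mono) auto
  moreover have "x * (2 * x ^ k) \<le> x * ((x + 1) ^ k + (x - 1) ^ k)"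
    using that by (intro mult_left_mono Suc.IH) auto
  ultimately show ?case by (simp add: algebra_simps)
qed simp

lemma summation_by_parts:
  fixes w e :: "nat \<Rightarrow> real"
  shows "(\<Sum>m=1..n. w m * (e m - e (Suc m))) = (\<Sum>m=1..n. (w m - w (m - 1)) * e m) + w 0 * e 1 - w n * e (Suc n)"
  by (induction n) (simp_all add: algebra_simps)

theorem theorem1p5:
  fixes k n :: nat
  assumes "1 \<le> k" and "1 \<le> n"
  shows "pos_crank_moment k n > pos_rank_moment k n"
proof -
  \<comment> \<open>Differences of \<open>e\<close> are crank count minus rank count, and
    differences of \<open>a\<close> are \<open>e\<close>; \<open>v\<close> and its differences are
    the first and second differences of the weights \<open>w\<close>.\<close>
  define e where "e r = crank_ge r $ n - rank_ge r $ n" for r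
  define a where "a j = spt_gf j 0 $ n" for j
  define w v :: "nat \<Rightarrow> real" where "w m = real m ^ k" and "v m = w m - w (m - 1)" for m
  have e_Suc_n: "e (Suc n) = 0"
    by (simp add: e_def crank_ge_nth_0 rank_ge_nth_0)
  have a_n: "a n = 0"
    by (simp add: a_def spt_gf_nth)
  have a_diff: "e m = a (m - 1) - a m" if "m \<in> {1..n}" for m
    using that by (simp add: a_def e_def spt_gf_nth sum.atLeast_Suc_atMost[of m])
  have sum_int: "(\<Sum>m\<in>{1..int n}. f m) = (\<Sum>m=1..n. f (int m))" for f :: "int \<Rightarrow> int"
    by (rule sum.reindex_bij_witness[of _ int nat]) auto
  have "real_of_int (pos_crank_moment k n - pos_rank_moment k n) =
      (\<Sum>m=1..n. w m * (e m - e (Suc m)))"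
    unfolding pos_crank_moment_def pos_rank_moment_def sum_int sum_subtractf[symmetric] of_int_sum
  proof (intro sum.cong refl)
    fix m assume "m \<in> {1..n}"
    then show "real_of_int (int m ^ k * M (int m) n - int m ^ k * N (int m) n) = w m * (e m - e (Suc m))"
      using assms(2) by (simp add: w_def e_def M_eq N_eq crank_gf_eq rank_gf_eq algebra_simps)
  qed
  also have "\<dots> = (\<Sum>m=1..n. v m * e m)"
  proof -
    \<comment> \<open>The boundary term at 0 vanishes because \<open>1 \<le> k\<close>.\<close>
    have "w 0 = 0" using assms(1) by (simp add: w_def)
    then show ?thesis
      unfolding summation_by_parts e_Suc_n v_def by simp
  qed
  also have "\<dots> = (\<Sum>m=1..n. v m * (a (m - 1) - a m))"
    by (intro sum.cong refl) (simp add: a_diff)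
  also have "\<dots> = (\<Sum>m=0..<n. v (Suc m) * (a m - a (Suc m)))"
    by (rule sum.reindex_bij_witness[of _ Suc "\<lambda>m. m - 1"]) auto
  \<comment> \<open>Second summation by parts; its upper boundary term vanishes by
    \<open>a_n\<close>.\<close>
  also have "\<dots> = v 1 * a 0 + (\<Sum>m=1..<n. (v (Suc m) - v m) * a m)"
  proof -
    have "(\<Sum>m=0..<i. v (Suc m) * (a m - a (Suc m))) =
        v 1 * a 0 + (\<Sum>m=1..<i. (v (Suc m) - v m) * a m) - v i * a i" if "1 \<le> i" for i
      using that by (induction i rule: dec_induct) (simp_all add: algebra_simps)
    from this[OF assms(2)] show ?thesis by (simp add: a_n)
  qed
  also have "\<dots> \<ge> v 1 * a 0"
  proof -
    have "0 \<le> (v (Suc m) - v m) * a m" if "m \<in> {1..<n}" for m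
    proof (rule mult_nonneg_nonneg)
      show "0 \<le> v (Suc m) - v m"
        using power_convex[of "real m" k] that by (simp add: v_def w_def of_nat_diff add.commute)
      show "0 \<le> a m"
        by (simp add: a_def spt_gf_nonneg)
    qed
    then have "0 \<le> (\<Sum>m=1..<n. (v (Suc m) - v m) * a m)" by (rule sum_nonneg)
    then show ?thesis by simp
  qed
  finally have "v 1 * a 0 \<le> real_of_int (pos_crank_moment k n - pos_rank_moment k n)" .
  moreover have "1 \<le> v 1 * a 0"
    \<comment> \<open>Here \<open>v 1 = 1\<close>, so strictness comes from the coefficient
      \<open>a 0\<close> alone.\<close>
    using spt_gf_0_pos[OF assms(2)] assms(1) by (simp add: v_def w_def a_def power_0_left)
  ultimately show ?thesis by linarith
qed

end
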